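(* Let $n \ge 10^9$ be an odd integer and let $k$ be an even integer with $\frac{2n}{5} < k < \frac{n}{2}$. Then $$t(n,k) = \frac{k}{4}(3k-n-1).$$ Moreover, every $n$-vertex $k$-regular graph with exactly $t(n,k)$ triangles belongs to the family $\mathcal{G}(n,k)$.
   Context: For positive integers $n,k$, $t(n,k)$ denotes the minimum number of triangles over all $k$-regular graphs on $n$ vertices. For odd $n$ and even $k$ with $\frac{2n}{5}<k<\frac n2$, the family $\mathcal{G}(n,k)$ is defined as follows. Let $G_0$ be a complete bipartite graph with parts $X, Y$, each of size $\frac{n-1}{2}$, and let $A \subseteq X$, $B \subseteq Y$ be subsets of size $\frac{k}{2}$. $\mathcal{G}(n,k)$ consists of all $n$-vertex graphs obtained from $G_0$ (over all such choices) by: adding a new vertex $v$ and joining $v$ to all vertices of $A \cup B$; removing the edges of a $\frac{n-2k+1}{2}$-factor (spanning $\frac{n-2k+1}{2}$-regular subgraph) of the induced subgraph $G_0[A\cup B]$; and removing the edges of a $\frac{n-2k-1}{2}$-factor of the induced subgraph $G_0[(X\setminus A)\cup(Y\setminus B)]$. *)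

theory Defs
  imports Complex_Main
begin

text \<open>A finite simple graph is given by its vertex set \<open>V\<close> and its set \<open>E\<close> of edges, an edge being
  an unordered pair of distinct vertices.\<close>

definition simple_graph :: "'a set \<Rightarrow> 'a set set \<Rightarrow> bool" where
  "simple_graph V E \<longleftrightarrow> finite V \<and> (\<forall>e\<in>E. e \<subseteq> V \<and> card e = 2)"

definition graph_degree :: "'a set set \<Rightarrow> 'a \<Rightarrow> nat" where
  "graph_degree E v = card {e \<in> E. v \<in> e}"

definition regular_graph :: "nat \<Rightarrow> 'a set \<Rightarrow> 'a set set \<Rightarrow> bool" where
  "regular_graph k V E \<longleftrightarrow> simple_graph V E \<and> (\<forall>v\<in>V. graph_degree E v = k)"

definition triangles :: "'a set \<Rightarrow> 'a set set \<Rightarrow> 'a set set" where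
  "triangles V E = {T. T \<subseteq> V \<and> card T = 3 \<and> (\<forall>x\<in>T. \<forall>y\<in>T. x \<noteq> y \<longrightarrow> {x, y} \<in> E)}"

text \<open>Up to isomorphism the vertex set of an \<open>n\<close>-vertex graph is \<open>{..<n}\<close>. The infimum of a nonempty
  set of naturals is its minimum; for the empty set it is an unspecified number.\<close>

definition min_triangles :: "nat \<Rightarrow> nat \<Rightarrow> nat" where
  "min_triangles n k = Inf {card (triangles {..<n} E) | E. regular_graph k {..<n} E}"

definition complete_bipartite_edges :: "'a set \<Rightarrow> 'a set \<Rightarrow> 'a set set" where
  "complete_bipartite_edges X Y = {{x, y} | x y. x \<in> X \<and> y \<in> Y}"

definition induced_edges :: "'a set set \<Rightarrow> 'a set \<Rightarrow> 'a set set" where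
  "induced_edges E S = {e \<in> E. e \<subseteq> S}"

text \<open>\<open>F\<close> is the edge set of a spanning \<open>r\<close>-regular subgraph of the graph \<open>(V, E)\<close>.\<close>

definition is_factor :: "nat \<Rightarrow> 'a set \<Rightarrow> 'a set set \<Rightarrow> 'a set set \<Rightarrow> bool" where
  "is_factor r V E F \<longleftrightarrow> F \<subseteq> E \<and> regular_graph r V F"

text \<open>The graphs \<open>(V, E)\<close> of the family \<open>\<G>(n,k)\<close>, which is meant for odd \<open>n\<close> and even \<open>k\<close> with
  \<open>2n/5 < k < n/2\<close>; for these, every natural subtraction and division below is exact.\<close>

definition extremal_family :: "nat \<Rightarrow> nat \<Rightarrow> ('a set \<times> 'a set set) set" where
  "extremal_family n k = {(V, E). \<exists>X Y A B v F1 F2.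
     finite X \<and> finite Y \<and> X \<inter> Y = {} \<and>
     card X = (n - 1) div 2 \<and> card Y = (n - 1) div 2 \<and>
     A \<subseteq> X \<and> B \<subseteq> Y \<and> card A = k div 2 \<and> card B = k div 2 \<and>
     v \<notin> X \<union> Y \<and>
     is_factor ((n + 1 - 2 * k) div 2) (A \<union> B)
       (induced_edges (complete_bipartite_edges X Y) (A \<union> B)) F1 \<and>
     is_factor ((n - 1 - 2 * k) div 2) ((X - A) \<union> (Y - B))
       (induced_edges (complete_bipartite_edges X Y) ((X - A) \<union> (Y - B))) F2 \<and>
     V = insert v (X \<union> Y) \<and>
     E = (complete_bipartite_edges X Y - F1 - F2) \<union> {{v, u} | u. u \<in> A \<union> B}}"

end

theory Submission imports Defs begin

text \<open>Suppose that a \<open>k\<close>-regular graph on \<open>n\<close> vertices has \<open>t \<le> k(3k - n - 1)/4\<close> triangles. Any three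
  vertices have codegrees summing to at least \<open>3k - n > n/5\<close>, so every triangle contains a heavy
  edge, one lying in at least \<open>(3k - n)/3\<close> triangles, and there are only \<open>O(n)\<close> heavy edges. Deleting
  them, together with the \<open>O(1)\<close> vertices on many of them, leaves a triangle-free graph of minimum
  degree at least \<open>k - n/1000\<close>. If that graph has a closed 5-walk, it is almost a balanced blow-up of
  the 5-cycle; but the five edges of a closed 5-walk lie in at least \<open>5k - 2n \<ge> 2\<close> triangles in
  total, and averaging over all 5-cycles gives too many triangles. Otherwise it is bipartite.

  Hence a maximum cut \<open>(X, Y)\<close>, where \<open>|X| > |Y|\<close>, has only \<open>O(n)\<close> edges inside the parts. Each of
  them lies in many triangles, which forces \<open>|X| = |Y| + 1\<close> and fewer than \<open>0.85 k\<close> inner edges. By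
  regularity \<open>X\<close> has exactly \<open>k/2\<close> more inner edges than \<open>Y\<close>, and a precise count yields the bound, with
  equality only if \<open>Y\<close> is independent and the inner edges of \<open>X\<close> form a star with \<open>k/2\<close> edges. Its
  centre is the vertex \<open>v\<close> of the family.\<close>

section \<open>Triangle-free graphs of large minimum degree\<close>

lemma card_eq_sum_indicator:
  assumes "finite U" "A \<subseteq> U"
  shows "card A = (\<Sum>w\<in>U. of_bool (w \<in> A))"
  using assms by (simp add: sum.If_cases of_bool_def Int_absorb1 inf.absorb2)

text \<open>An element of j of the three sets lies in at least j - 1 of the pairwise intersections.
  For neighbourhoods this bounds the codegrees of any three vertices from below.\<close>

lemma three_sets_card_le:
  assumes "finite U" "A \<subseteq> U" "B \<subseteq> U" "C \<subseteq> U"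
  shows "card A + card B + card C
    \<le> card U + card (A \<inter> B) + card (B \<inter> C) + card (A \<inter> C)"
proof -
  have U: "card U = (\<Sum>w\<in>U. 1)" by simp
  have sub: "A \<inter> B \<subseteq> U" "B \<inter> C \<subseteq> U" "A \<inter> C \<subseteq> U" using assms by auto
  show ?thesis
    unfolding U assms(2-4)[THEN card_eq_sum_indicator[OF assms(1)]]
      sub[THEN card_eq_sum_indicator[OF assms(1)]] sum.distrib[symmetric]
    by (rule sum_mono) auto
qed

text \<open>Any j of five cyclically ordered sets include at least j - 2 consecutive pairs, so the
  inequality holds element by element.\<close>

lemma five_sets_card_le:
  assumes "finite U" "A \<subseteq> U" "B \<subseteq> U" "C \<subseteq> U" "D \<subseteq> U" "F \<subseteq> U"
  shows "card A + card B + card C + card D + card F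
    \<le> 2 * card U + card (A \<inter> B) + card (B \<inter> C) + card (C \<inter> D) + card (D \<inter> F) + card (F \<inter> A)"
proof -
  have U: "2 * card U = (\<Sum>w\<in>U. 2)" by simp
  have sub: "A \<inter> B \<subseteq> U" "B \<inter> C \<subseteq> U" "C \<inter> D \<subseteq> U" "D \<inter> F \<subseteq> U" "F \<inter> A \<subseteq> U"
    using assms by auto
  show ?thesis
    unfolding U assms(2-6)[THEN card_eq_sum_indicator[OF assms(1)]]
      sub[THEN card_eq_sum_indicator[OF assms(1)]] sum.distrib[symmetric]
    by (rule sum_mono) (auto simp: of_bool_def)
qed

text \<open>No element lies in three of the sets, since any three include two consecutive ones. An
  element of \<open>A\<close> outside \<open>C\<close> and \<open>D\<close> lies in no other set,
  which leaves room for counting it once more.\<close>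

lemma five_disjoint_sets_card_le:
  assumes "finite U" "A \<subseteq> U" "B \<subseteq> U" "C \<subseteq> U" "D \<subseteq> U" "F \<subseteq> U"
    and "A \<inter> B = {}" "B \<inter> C = {}" "C \<inter> D = {}" "D \<inter> F = {}" "F \<inter> A = {}"
  shows "card A + card B + card C + card D + card F + card (A - C - D) \<le> 2 * card U"
proof -
  have U: "2 * card U = (\<Sum>w\<in>U. 2)" by simp
  have sub: "A - C - D \<subseteq> U" using assms by auto
  show ?thesis
    unfolding U assms(2-6)[THEN card_eq_sum_indicator[OF assms(1)]]
      card_eq_sum_indicator[OF assms(1) sub] sum.distrib[symmetric]
    by (rule sum_mono) (use assms in \<open>auto simp: of_bool_def\<close>)
qed

section \<open>Neighbourhood classes around a closed 5-walk\<close>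

definition closed_walk5 :: "('a \<Rightarrow> 'a set) \<Rightarrow> 'a \<Rightarrow> 'a \<Rightarrow> 'a \<Rightarrow> 'a \<Rightarrow> 'a \<Rightarrow> bool" where
  "closed_walk5 N a b c d e \<longleftrightarrow> b \<in> N a \<and> c \<in> N b \<and> d \<in> N c \<and> e \<in> N d \<and> a \<in> N e"

text \<open>\<open>N\<close> is an abstract neighbourhood function and \<open>N_disj\<close>
  expresses triangle-freeness. \<open>W\<close> may have fewer than \<open>n\<close> elements,
  because the application deletes vertices.\<close>

locale triangle_free_dense =
  fixes W :: "'a set" and N :: "'a \<Rightarrow> 'a set" and n D :: nat
  assumes fin: "finite W" and card_W: "card W \<le> n"
    and N_sub: "x \<in> W \<Longrightarrow> N x \<subseteq> W"
    and N_sym: "x \<in> W \<Longrightarrow> y \<in> W \<Longrightarrow> y \<in> N x \<Longrightarrow> x \<in> N y"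
    and N_disj: "x \<in> W \<Longrightarrow> y \<in> N x \<Longrightarrow> N x \<inter> N y = {}"
    and deg: "x \<in> W \<Longrightarrow> D \<le> card (N x)"
begin

lemma fin_N: "x \<in> W \<Longrightarrow> finite (N x)"
  using fin N_sub finite_subset by blast

text \<open>\<open>P\<close> consists of the vertices sharing a neighbour with a fixed
  \<open>x\<close>. An edge inside \<open>P\<close> yields a closed 5-walk through \<open>x\<close>;
  an edge \<open>yz\<close> outside \<open>P\<close> makes \<open>N x\<close>, \<open>N y\<close>,
  \<open>N z\<close> pairwise disjoint, against \<open>n < 3 * D\<close>.\<close>

lemma bipartite_if_no_closed_walk5:
  assumes "n < 3 * D" and "\<And>a b c d e. a \<in> W \<Longrightarrow> \<not> closed_walk5 N a b c d e"
  shows "\<exists>P\<subseteq>W. (\<forall>x\<in>P. N x \<inter> P = {}) \<and> (\<forall>x\<in>W-P. N x \<inter> (W - P) = {})"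
proof (cases "W = {}")
  case False
  then obtain x where x: "x \<in> W" by blast
  define P where "P = {y\<in>W. N y \<inter> N x \<noteq> {}}"
  have "N y \<inter> P = {}" if y: "y \<in> P" for y
  proof (rule ccontr)
    assume "N y \<inter> P \<noteq> {}"
    then obtain z where z: "z \<in> N y" "z \<in> P" by blast
    obtain a b where "a \<in> N y \<inter> N x" "b \<in> N z \<inter> N x" using y z by (auto simp: P_def)
    moreover have "a \<in> W" "b \<in> W" using calculation x N_sub by auto
    ultimately have "closed_walk5 N x a y z b"
      using x y z N_sym unfolding closed_walk5_def P_def by blast
    then show False using assms(2) x by blast
  qed
  moreover have "N y \<inter> (W - P) = {}" if y: "y \<in> W - P" for y
  proof (rule ccontr)
    assume "N y \<inter> (W - P) \<noteq> {}"
    then obtain z where z: "z \<in> N y" "z \<in> W - P" by blast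
    have yz: "N y \<inter> N z = {}" "N y \<inter> N x = {}" "N z \<inter> N x = {}"
      using N_disj y z by (auto simp: P_def)
    have "card (N x) + card (N y) + card (N z) \<le> card W"
      using three_sets_card_le[OF fin, of "N x" "N y" "N z"] x y z yz N_sub
      by (auto simp: Int_commute)
    then show False
      using deg[of x] deg[of y] deg[of z] x y z assms(1) card_W by auto
  qed
  ultimately show ?thesis unfolding P_def by (intro exI[of _ P]) (auto simp: P_def)
qed auto

context
  fixes a b c d e
  assumes aW: "a \<in> W" and walk: "closed_walk5 N a b c d e"
begin

lemma walk_in: "b \<in> W" "c \<in> W" "d \<in> W" "e \<in> W"
  using walk aW N_sub unfolding closed_walk5_def by blast+

lemma walk_disj: "N a \<inter> N b = {}" "N b \<inter> N c = {}" "N c \<inter> N d = {}" "N d \<inter> N e = {}" "N e \<inter> N a = {}"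
  using walk N_disj aW walk_in unfolding closed_walk5_def by blast+

text \<open>\<open>N a \<inter> N c\<close> is the class of the vertices that can replace
  \<open>b\<close> in the walk. It, \<open>N d\<close> and \<open>N e\<close> are pairwise
  disjoint.\<close>

lemma class_le: "card (N a \<inter> N c) + 2 * D \<le> n"
proof -
  have "card ((N a \<inter> N c) \<union> (N d \<union> N e)) \<le> card W"
    using fin N_sub aW walk_in by (intro card_mono) auto
  moreover have "card ((N a \<inter> N c) \<union> (N d \<union> N e)) = card (N a \<inter> N c) + (card (N d) + card (N e))"
    using fin_N aW walk_in walk_disj by (subst card_Un_disjoint, auto)+
  ultimately show ?thesis using deg[of d] deg[of e] walk_in card_W by linarith
qed

lemma five_D_le: "5 * D \<le> 2 * n"
  using five_disjoint_sets_card_le[OF fin N_sub[OF aW] walk_in[THEN N_sub] walk_disj]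
    deg[OF aW] walk_in[THEN deg] card_W by linarith

end

text \<open>The part of \<open>N a\<close> outside \<open>N c\<close> and \<open>N d\<close> is
  small by the extra term of \<open>five_disjoint_sets_card_le\<close>, and
  \<open>N a \<inter> N d\<close> is small by \<open>class_le\<close> for a rotated walk. For
  \<open>D\<close> near \<open>2n/5\<close> both class bounds are near \<open>n/5\<close>.\<close>

lemma class_ge:
  assumes "a \<in> W" and walk: "closed_walk5 N a b c d e"
  shows "8 * D \<le> card (N a \<inter> N c) + 3 * n"
proof -
  note W = assms(1) walk_in[OF assms]
  have "closed_walk5 N d e a b c" using walk unfolding closed_walk5_def by blast
  from class_le[OF W(4) this] have le: "card (N a \<inter> N d) + 2 * D \<le> n" by (simp add: Int_commute)
  have "card (N a) + card (N b) + card (N c) + card (N d) + card (N e) + card (N a - N c - N d) \<le> 2 * card W"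
    using five_disjoint_sets_card_le[OF fin W[THEN N_sub] walk_disj[OF assms]] .
  then have "card (N a - N c - N d) + 4 * D + card (N a) \<le> 2 * n"
    using W[THEN deg] card_W by linarith
  moreover have "card (N a) \<le> card (N a - N c - N d) + (card (N a \<inter> N c) + card (N a \<inter> N d))"
  proof -
    have "N a = (N a - N c - N d) \<union> ((N a \<inter> N c) \<union> (N a \<inter> N d))" by auto
    then show ?thesis by (metis card_Un_le add_left_mono order_trans)
  qed
  ultimately show ?thesis using le deg[OF W(1)] by linarith
qed

text \<open>A vertex \<open>y\<close> in the class of \<open>b\<close> is joined to almost all of
  the class of \<open>c\<close>: its non-neighbours there, \<open>N y\<close> and
  \<open>N a \<union> N c\<close> are pairwise disjoint, and the last set is large by
  \<open>class_le\<close>.\<close>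

lemma class_missing_le:
  assumes "a \<in> W" and walk: "closed_walk5 N a b c d e" and y: "y \<in> N a \<inter> N c"
  shows "card (N b \<inter> N d - N y) + 5 * D \<le> 2 * n"
proof -
  note W = assms(1) walk_in[OF assms(1,2)]
  note disj = walk_disj[OF assms(1,2)]
  have yW: "y \<in> W" using y W N_sub by blast
  have dy: "N a \<inter> N y = {}" "N c \<inter> N y = {}" using y N_disj W by auto
  have "card ((N a \<union> N c) \<union> (N y \<union> (N b \<inter> N d - N y))) \<le> card W"
    using fin N_sub W yW by (intro card_mono) auto
  moreover have "card ((N a \<union> N c) \<union> (N y \<union> (N b \<inter> N d - N y)))
      = card (N a \<union> N c) + card (N y \<union> (N b \<inter> N d - N y))"
    using fin_N[OF W(1)] fin_N[OF W(2)] fin_N[OF W(3)] fin_N[OF yW] disj dy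
    by (intro card_Un_disjoint) auto
  moreover have "card (N y \<union> (N b \<inter> N d - N y)) = card (N y) + card (N b \<inter> N d - N y)"
    using fin_N[OF W(2)] fin_N[OF yW] by (intro card_Un_disjoint) auto
  moreover have "card (N a) + card (N c) = card (N a \<union> N c) + card (N a \<inter> N c)"
    using card_Un_Int fin_N W by blast
  ultimately show ?thesis
    using class_le[OF assms(1,2)] deg[OF W(1)] deg[OF W(3)] deg[OF yW] card_W by linarith
qed

text \<open>Around a closed 5-walk the graph is almost a balanced blow-up of the 5-cycle with classes
  \<open>U0, \<dots>, U4\<close>. Averaging the hypothesis on \<open>w\<close> over all transversals, where a
  non-adjacent pair is given the weight 2, bounds the total weight from below.\<close>

lemma closed_walk5_weight:
  fixes w :: "'a \<Rightarrow> 'a \<Rightarrow> nat"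
  assumes aW: "a \<in> W" and walk: "closed_walk5 N a b c d e"
    and w_sym: "\<And>x y. w x y = w y x"
    and w_walk: "\<And>x0 x1 x2 x3 x4. x0 \<in> W \<Longrightarrow> closed_walk5 N x0 x1 x2 x3 x4 \<Longrightarrow>
      2 \<le> w x0 x1 + w x1 x2 + w x2 x3 + w x3 x4 + w x4 x0"
    and m: "0 < m" "m + 3 * n \<le> 8 * D" and s: "2 * n \<le> 5 * D + s"
  shows "4 * m * m \<le> (\<Sum>x\<in>W. \<Sum>y\<in>N x. w x y) + 20 * m * s"
proof -
  note W = aW walk_in[OF aW walk]
  note disj = walk_disj[OF aW walk]
  have walks: "closed_walk5 N b c d e a" "closed_walk5 N c d e a b"
    "closed_walk5 N d e a b c" "closed_walk5 N e a b c d"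
    using walk unfolding closed_walk5_def by blast+
  have sz: "m \<le> card (N e \<inter> N b)" "m \<le> card (N a \<inter> N c)" "m \<le> card (N b \<inter> N d)"
      "m \<le> card (N c \<inter> N e)" "m \<le> card (N d \<inter> N a)"
    using class_ge[OF W(1) walk] class_ge[OF W(2) walks(1)] class_ge[OF W(3) walks(2)]
      class_ge[OF W(4) walks(3)] class_ge[OF W(5) walks(4)] m by linarith+
  \<comment> \<open>\<open>U0\<close>, ..., \<open>U4\<close> are the classes of \<open>a\<close>,
    ..., \<open>e\<close>, trimmed to size exactly \<open>m\<close> so that the average over
    transversals is uniform.\<close>
  obtain U0 where U0: "U0 \<subseteq> N e \<inter> N b" "card U0 = m" "finite U0" using obtain_subset_with_card_n[OF sz(1)] by blast
  obtain U1 where U1: "U1 \<subseteq> N a \<inter> N c" "card U1 = m" "finite U1" using obtain_subset_with_card_n[OF sz(2)] by blast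
  obtain U2 where U2: "U2 \<subseteq> N b \<inter> N d" "card U2 = m" "finite U2" using obtain_subset_with_card_n[OF sz(3)] by blast
  obtain U3 where U3: "U3 \<subseteq> N c \<inter> N e" "card U3 = m" "finite U3" using obtain_subset_with_card_n[OF sz(4)] by blast
  obtain U4 where U4: "U4 \<subseteq> N d \<inter> N a" "card U4 = m" "finite U4" using obtain_subset_with_card_n[OF sz(5)] by blast
  have UW: "U0 \<subseteq> W" "U1 \<subseteq> W" "U2 \<subseteq> W" "U3 \<subseteq> W" "U4 \<subseteq> W"
    using U0(1) U1(1) U2(1) U3(1) U4(1) W[THEN N_sub] by blast+
  have Udisj: "U0 \<inter> U1 = {}" "U0 \<inter> U2 = {}" "U0 \<inter> U3 = {}" "U0 \<inter> U4 = {}" "U1 \<inter> U2 = {}"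
    "U1 \<inter> U3 = {}" "U1 \<inter> U4 = {}" "U2 \<inter> U3 = {}" "U2 \<inter> U4 = {}" "U3 \<inter> U4 = {}"
    using U0(1) U1(1) U2(1) U3(1) U4(1) disj by blast+
  define g where "g x y = (if y \<in> N x then w x y else 2)" for x y
  define lw where "lw x y = (if y \<in> N x then w x y else 0)" for x y
  define R where "R A B = (\<Sum>x\<in>A. \<Sum>y\<in>B. lw x y)" for A B
  define S where "S A B = (\<Sum>x\<in>A. \<Sum>y\<in>B. g x y)" for A B
  have g: "2 \<le> g x0 x1 + g x1 x2 + g x2 x3 + g x3 x4 + g x4 x0" if "x0 \<in> U0" for x0 x1 x2 x3 x4
    using w_walk[of x0 x1 x2 x3 x4] that UW unfolding g_def closed_walk5_def by auto
  have "(\<Sum>x0\<in>U0. \<Sum>x1\<in>U1. \<Sum>x2\<in>U2. \<Sum>x3\<in>U3. \<Sum>x4\<in>U4. 2)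
     \<le> (\<Sum>x0\<in>U0. \<Sum>x1\<in>U1. \<Sum>x2\<in>U2. \<Sum>x3\<in>U3. \<Sum>x4\<in>U4.
          g x0 x1 + g x1 x2 + g x2 x3 + g x3 x4 + g x4 x0)"
    by (intro sum_mono g)
  \<comment> \<open>A pair from two consecutive classes lies in \<open>m^3\<close>
    transversals.\<close>
  also have "\<dots> = m^3 * (S U0 U1 + S U1 U2 + S U2 U3 + S U3 U4 + S U4 U0)"
  proof -
    have "(\<Sum>x0\<in>U0. \<Sum>x4\<in>U4. g x4 x0) = S U4 U0"
      unfolding S_def by (rule sum.swap)
    then show ?thesis
      by (simp add: sum.distrib S_def U0(2) U1(2) U2(2) U3(2) U4(2) sum_distrib_left[symmetric]
          algebra_simps power3_eq_cube)
  qed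
  finally have "m^3 * (2 * m * m) \<le> m^3 * (S U0 U1 + S U1 U2 + S U2 U3 + S U3 U4 + S U4 U0)"
    by (simp add: U0(2) U1(2) U2(2) U3(2) U4(2) power3_eq_cube mult_ac)
  then have main: "2 * m * m \<le> S U0 U1 + S U1 U2 + S U2 U3 + S U3 U4 + S U4 U0"
    using m(1) by simp
  \<comment> \<open>Passing from \<open>g\<close> to \<open>lw\<close> costs 2 per non-adjacent
    pair, and each vertex misses at most \<open>s\<close> vertices of the next class.\<close>
  have SR: "S A B \<le> R A B + 2 * (m * s)"
    if "card A = m" "finite A" "finite B" "\<And>x. x \<in> A \<Longrightarrow> card (B - N x) \<le> s" for A B
  proof -
    have "(\<Sum>y\<in>B. g x y) \<le> (\<Sum>y\<in>B. lw x y) + 2 * s" if x: "x \<in> A" for x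
    proof -
      have "(\<Sum>y\<in>B. g x y) = (\<Sum>y\<in>B. lw x y + 2 * of_bool (y \<in> B - N x))"
        by (intro sum.cong) (auto simp: g_def lw_def)
      also have "\<dots> = (\<Sum>y\<in>B. lw x y) + 2 * card (B - N x)"
        using card_eq_sum_indicator[of B "B - N x"] \<open>finite B\<close>
        by (simp add: sum.distrib sum_distrib_left[symmetric] del: Diff_iff sum_of_bool_eq)
      finally show ?thesis using \<open>\<And>x. x \<in> A \<Longrightarrow> card (B - N x) \<le> s\<close>[OF x] by simp
    qed
    then have "S A B \<le> (\<Sum>x\<in>A. (\<Sum>y\<in>B. lw x y) + 2 * s)"
      unfolding S_def by (intro sum_mono)
    also have "\<dots> = R A B + 2 * (m * s)"
      by (simp add: R_def sum.distrib \<open>card A = m\<close>)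
    finally show ?thesis .
  qed
  have miss: "card (B' - N x) \<le> s" if "card (C' - N x) + 5 * D \<le> 2 * n" "B' \<subseteq> C'" "finite C'" for B' C' x
  proof -
    have "card (B' - N x) \<le> card (C' - N x)" using that by (intro card_mono) auto
    then show ?thesis using that s by linarith
  qed
  have finI: "finite (N x \<inter> N y)" if "x \<in> W" for x y using fin_N[OF that] by simp
  have S1: "S U0 U1 \<le> R U0 U1 + 2 * (m * s)"
    using U0(1) by (intro SR U0 U1 miss[OF class_missing_le[OF W(5) walks(4)] U1(1) finI[OF W(1)]]) blast
  have S2: "S U1 U2 \<le> R U1 U2 + 2 * (m * s)"
    using U1(1) by (intro SR U1 U2 miss[OF class_missing_le[OF W(1) walk] U2(1) finI[OF W(2)]]) blast
  have S3: "S U2 U3 \<le> R U2 U3 + 2 * (m * s)"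
    using U2(1) by (intro SR U2 U3 miss[OF class_missing_le[OF W(2) walks(1)] U3(1) finI[OF W(3)]]) blast
  have S4: "S U3 U4 \<le> R U3 U4 + 2 * (m * s)"
    using U3(1) by (intro SR U3 U4 miss[OF class_missing_le[OF W(3) walks(2)] U4(1) finI[OF W(4)]]) blast
  have S5: "S U4 U0 \<le> R U4 U0 + 2 * (m * s)"
    using U4(1) by (intro SR U4 U0 miss[OF class_missing_le[OF W(4) walks(3)] U0(1) finI[OF W(5)]]) blast
  have lw_sym: "lw x y = lw y x" if "x \<in> W" "y \<in> W" for x y
    unfolding lw_def using N_sym that w_sym by auto
  have R_sym: "R A B = R B A" if "A \<subseteq> W" "B \<subseteq> W" for A B
    unfolding R_def using that by (subst sum.swap) (auto intro!: sum.cong lw_sym)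
  have R_W: "R A B + R A C \<le> R A W" if "B \<subseteq> W" "C \<subseteq> W" "B \<inter> C = {}" for A B C
  proof -
    have "R A B + R A C = R A (B \<union> C)"
      using that finite_subset[OF _ fin]
      by (simp add: R_def sum.union_disjoint sum.distrib)
    also have "\<dots> \<le> R A W"
      unfolding R_def using that fin by (intro sum_mono sum_mono2) auto
    finally show ?thesis .
  qed
  have "R U0 W + R U1 W + R U2 W + R U3 W + R U4 W = R (U0 \<union> U1 \<union> U2 \<union> U3 \<union> U4) W"
    using U0(3) U1(3) U2(3) U3(3) U4(3) Udisj
    by (simp add: R_def sum.union_disjoint Int_Un_distrib2)
  also have "\<dots> \<le> R W W"
    unfolding R_def using UW fin by (intro sum_mono2) auto
  finally have "R U0 W + R U1 W + R U2 W + R U3 W + R U4 W \<le> R W W" .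
  \<comment> \<open>Each class has two neighbouring classes, so the weight between consecutive
    classes is seen from both ends; this doubles the constants.\<close>
  moreover have "R U0 U1 + R U4 U0 \<le> R U0 W" "R U1 U2 + R U0 U1 \<le> R U1 W"
    "R U2 U3 + R U1 U2 \<le> R U2 W" "R U3 U4 + R U2 U3 \<le> R U3 W" "R U4 U0 + R U3 U4 \<le> R U4 W"
    using R_W[of U1 U4 U0] R_W[of U2 U0 U1] R_W[of U3 U1 U2] R_W[of U4 U2 U3] R_W[of U0 U3 U4] UW Udisj
    by (simp_all add: R_sym[OF UW(1) UW(5)] R_sym[OF UW(2) UW(1)] R_sym[OF UW(3) UW(2)]
        R_sym[OF UW(4) UW(3)] R_sym[OF UW(5) UW(4)] Int_commute)
  ultimately have "(R U0 U1 + R U4 U0) + (R U1 U2 + R U0 U1) + (R U2 U3 + R U1 U2) + (R U3 U4 + R U2 U3)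
      + (R U4 U0 + R U3 U4) \<le> R W W"
    by (meson add_mono order_trans)
  then have "2 * (R U0 U1 + R U1 U2 + R U2 U3 + R U3 U4 + R U4 U0) \<le> R W W"
    by simp
  moreover have "2 * m * m \<le> R U0 U1 + R U1 U2 + R U2 U3 + R U3 U4 + R U4 U0 + 10 * (m * s)"
    using main S1 S2 S3 S4 S5 by linarith
  moreover have "R W W = (\<Sum>x\<in>W. \<Sum>y\<in>N x. w x y)"
    unfolding R_def lw_def sum.inter_restrict[OF fin, symmetric]
    by (intro sum.cong[OF refl]) (simp add: Int_absorb1 N_sub)
  ultimately show ?thesis by simp
qed

end

section \<open>Regular graphs\<close>

lemma graph_degree_eq:
  assumes "simple_graph V E"
  shows "graph_degree E x = card {y. {x, y} \<in> E}"
proof -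
  have "bij_betw (\<lambda>y. {x, y}) {y. {x, y} \<in> E} {e \<in> E. x \<in> e}"
  proof (rule bij_betw_imageI)
    show "inj_on (\<lambda>y. {x, y}) {y. {x, y} \<in> E}"
      by (auto simp: inj_on_def doubleton_eq_iff)
    show "(\<lambda>y. {x, y}) ` {y. {x, y} \<in> E} = {e \<in> E. x \<in> e}"
    proof (intro subset_antisym subsetI)
      fix e assume e: "e \<in> {e \<in> E. x \<in> e}"
      then obtain u v where "e = {u, v}"
        using assms by (auto simp: simple_graph_def card_2_iff)
      then show "e \<in> (\<lambda>y. {x, y}) ` {y. {x, y} \<in> E}"
        using e by (auto simp: insert_commute)
    qed auto
  qed
  then show ?thesis by (simp add: bij_betw_same_card graph_degree_def)
qed

locale regular_graph_on =
  fixes V :: "'a set" and E :: "'a set set" and k :: nat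
  assumes regular: "regular_graph k V E"
begin

definition nb :: "'a \<Rightarrow> 'a set" where "nb x = {y. {x, y} \<in> E}"

abbreviation "t \<equiv> card (triangles V E)"

lemma fin_V: "finite V" and edge_sub: "e \<in> E \<Longrightarrow> e \<subseteq> V" and edge_card: "e \<in> E \<Longrightarrow> card e = 2"
  using regular by (auto simp: regular_graph_def simple_graph_def)

lemma nb_sub: "nb x \<subseteq> V"
  using edge_sub by (auto simp: nb_def)

lemma nb_sym: "y \<in> nb x \<Longrightarrow> x \<in> nb y"
  by (simp add: nb_def insert_commute)

lemma nb_in: "y \<in> nb x \<Longrightarrow> x \<in> V"
  using nb_sub nb_sym by blast

lemma not_nb_self: "x \<notin> nb x"
  using edge_card[of "{x}"] by (auto simp: nb_def)

lemma fin_nb: "finite (nb x)"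
  using nb_sub fin_V finite_subset by blast

lemma card_nb: "x \<in> V \<Longrightarrow> card (nb x) = k"
  using regular graph_degree_eq[of V E x] by (simp add: regular_graph_def nb_def)

lemma cross_count:
  assumes "finite A" "finite B"
  shows "(\<Sum>x\<in>A. card (nb x \<inter> B)) = (\<Sum>y\<in>B. card (nb y \<inter> A))"
proof -
  have "(\<Sum>x\<in>A. card (nb x \<inter> B)) = card (SIGMA x:A. nb x \<inter> B)"
    using assms by simp
  also have "\<dots> = card (SIGMA y:B. nb y \<inter> A)"
  proof (rule bij_betw_same_card[of prod.swap], rule bij_betw_imageI)
    show "prod.swap ` (SIGMA x:A. nb x \<inter> B) = (SIGMA y:B. nb y \<inter> A)"
      by (auto dest: nb_sym simp: image_iff)
  qed simp
  finally show ?thesis using assms by simp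
qed

text \<open>Each triangle gives six triples, and codegree sums become cardinalities of
  \<open>SIGMA\<close> sets of triples.\<close>

definition ordered_triangles :: "('a \<times> 'a \<times> 'a) set" where
  "ordered_triangles = {(x, y, z). y \<in> nb x \<and> z \<in> nb x \<and> z \<in> nb y}"

lemma fin_ordered_triangles: "finite ordered_triangles"
  by (rule finite_subset[of _ "V \<times> V \<times> V"])
    (use nb_in nb_sub fin_V in \<open>auto simp: ordered_triangles_def\<close>)

lemma card_ordered_triangles: "card ordered_triangles = 6 * t"
proof -
  define F where "F T = {(x, y, z). {x, y, z} = T \<and> (x, y, z) \<in> ordered_triangles}" for T
  have "triangles V E \<subseteq> Pow V" by (auto simp: triangles_def)
  then have fin: "finite (triangles V E)" using fin_V finite_subset by blast
  have un: "ordered_triangles = (\<Union>T\<in>triangles V E. F T)"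
  proof (intro subset_antisym subsetI)
    fix p assume p: "p \<in> ordered_triangles"
    obtain x y z where xyz: "p = (x, y, z)" by (cases p)
    have "x \<noteq> y" "x \<noteq> z" "y \<noteq> z" using p not_nb_self by (auto simp: ordered_triangles_def xyz)
    moreover have "x \<in> V" "y \<in> V" "z \<in> V"
      using p nb_in nb_sub by (auto simp: ordered_triangles_def xyz)
    moreover have "{x,y} \<in> E" "{x,z} \<in> E" "{y,z} \<in> E"
      using p by (auto simp: ordered_triangles_def xyz nb_def)
    ultimately have "{x, y, z} \<in> triangles V E"
      by (auto simp: triangles_def insert_commute)
    then show "p \<in> (\<Union>T\<in>triangles V E. F T)" using p by (auto simp: F_def xyz)
  qed (auto simp: F_def)
  have six: "card (F T) = 6" if T: "T \<in> triangles V E" for T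
  proof -
    obtain x y z where xyz: "T = {x, y, z}" "x \<noteq> y" "x \<noteq> z" "y \<noteq> z"
      using T by (auto simp: triangles_def card_3_iff)
    have e: "{x,y} \<in> E" "{x,z} \<in> E" "{y,z} \<in> E"
      using T xyz by (auto simp: triangles_def)
    then have e': "{y,x} \<in> E" "{z,x} \<in> E" "{z,y} \<in> E" by (simp_all add: insert_commute)
    have "F T = {(x,y,z), (x,z,y), (y,x,z), (y,z,x), (z,x,y), (z,y,x)}"
    proof (intro subset_antisym subsetI)
      fix p assume p: "p \<in> F T"
      obtain u v w where p': "p = (u, v, w)" by (cases p)
      have eq: "{u, v, w} = {x, y, z}" using p by (simp add: F_def p' xyz)
      have "u \<noteq> v" "u \<noteq> w" "v \<noteq> w"
        using p not_nb_self by (auto simp: F_def p' ordered_triangles_def)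
      moreover have "u \<in> {x,y,z}" "v \<in> {x,y,z}" "w \<in> {x,y,z}" using eq by auto
      ultimately show "p \<in> {(x,y,z), (x,z,y), (y,x,z), (y,z,x), (z,x,y), (z,y,x)}"
        unfolding p' by auto
    next
      fix p assume "p \<in> {(x,y,z), (x,z,y), (y,x,z), (y,z,x), (z,x,y), (z,y,x)}"
      then show "p \<in> F T" using e e' by (auto simp: F_def xyz ordered_triangles_def nb_def)
    qed
    then show ?thesis using xyz by simp
  qed
  have "card ordered_triangles = (\<Sum>T\<in>triangles V E. card (F T))"
    unfolding un
  proof (rule card_UN_disjoint[OF fin])
    show "\<forall>T\<in>triangles V E. finite (F T)"
      using six by (metis card.infinite zero_neq_numeral)
  qed (auto simp: F_def)
  then show ?thesis using six by simp
qed

lemma codegree_sum: "(\<Sum>x\<in>V. \<Sum>y\<in>nb x. card (nb x \<inter> nb y)) = 6 * t"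
proof -
  have "ordered_triangles = (SIGMA x:V. SIGMA y:nb x. nb x \<inter> nb y)"
    using nb_in by (auto simp: ordered_triangles_def)
  then show ?thesis
    using card_ordered_triangles fin_V fin_nb by simp
qed

end

section \<open>Regular graphs with few triangles\<close>

context regular_graph_on
begin

definition cut :: "'a set \<Rightarrow> nat" where "cut S = (\<Sum>x\<in>S. card (nb x - S))"

text \<open>Twice the number of edges inside \<open>S\<close>.\<close>

definition inner :: "'a set \<Rightarrow> nat" where "inner S = (\<Sum>x\<in>S. card (nb x \<inter> S))"

lemma cut_eq: "S \<subseteq> V \<Longrightarrow> cut S = (\<Sum>x\<in>S. card (nb x \<inter> (V - S)))"
  unfolding cut_def using nb_sub by (intro sum.cong) (auto intro!: arg_cong[of _ _ card])

lemma cut_compl: assumes "S \<subseteq> V" shows "cut (V - S) = cut S"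
proof -
  have "V - (V - S) = S" using assms by auto
  then show ?thesis
    using cut_eq[OF assms] cut_eq[of "V - S"] cross_count[of S "V - S"] fin_V
      finite_subset[OF assms fin_V]
    by simp
qed

lemma inner_plus_cut: assumes "S \<subseteq> V" shows "inner S + cut S = card S * k"
proof -
  have "inner S + cut S = (\<Sum>x\<in>S. card (nb x \<inter> S) + card (nb x - S))"
    by (simp add: inner_def cut_def sum.distrib)
  also have "\<dots> = (\<Sum>x\<in>S. k)"
    using assms card_nb fin_nb by (intro sum.cong) (auto simp: card_Int_Diff[symmetric])
  finally show ?thesis by simp
qed

lemma cut_remove:
  assumes "S \<subseteq> V" "v \<in> S"
  shows "cut (S - {v}) + card (nb v - S) = cut S + card (nb v \<inter> S)"
proof -
  have fin: "finite S" using assms fin_V finite_subset by blast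
  have "card (nb x - (S - {v})) = card (nb x - S) + card (nb x \<inter> {v})" if "x \<in> S" for x
  proof -
    have "nb x - (S - {v}) = (nb x - S) \<union> (nb x \<inter> {v})" using assms by auto
    then show ?thesis using assms fin_nb by (auto intro!: card_Un_disjoint)
  qed
  then have "cut (S - {v}) = (\<Sum>x\<in>S - {v}. card (nb x - S)) + (\<Sum>x\<in>S - {v}. card (nb x \<inter> {v}))"
    by (simp add: cut_def sum.distrib)
  moreover have "(\<Sum>x\<in>S - {v}. card (nb x \<inter> {v})) = card (nb v \<inter> S)"
    using cross_count[of "S - {v}" "{v}"] fin not_nb_self[of v]
    by (simp add: Diff_Int_distrib Int_absorb2 Int_insert_right)
  moreover have "cut S = card (nb v - S) + (\<Sum>x\<in>S - {v}. card (nb x - S))"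
    unfolding cut_def using fin assms by (simp add: sum.remove)
  ultimately show ?thesis by simp
qed

text \<open>Moving \<open>v\<close> to the other side changes the cut by its inner degree minus its
  outer degree, so the inner degree cannot be the larger one.\<close>

lemma max_cut_inner_degree:
  assumes S: "S \<subseteq> V" and max: "\<And>S'. S' \<subseteq> V \<Longrightarrow> cut S' \<le> cut S" and v: "v \<in> S"
  shows "2 * card (nb v \<inter> S) \<le> k"
proof -
  have "card (nb v \<inter> S) + card (nb v - S) = k"
    using card_Int_Diff[OF fin_nb, of v S] card_nb v S by auto
  then show ?thesis
    using cut_remove[OF S v] max[of "S - {v}"] S by fastforce
qed

end

section \<open>Heavy edges and the approximate bipartition\<close>

locale few_triangles = regular_graph_on +
  fixes n :: nat
  assumes card_V: "card V = n" and n_large: "10 ^ 9 \<le> n" and odd_n: "odd n" and even_k: "even k"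
    and k_lower: "2 * n < 5 * k" and k_upper: "2 * k < n"
    \<comment> \<open>\<open>4 * t \<le> k * (3 * k - n - 1)\<close> without truncated subtraction\<close>
    and few: "4 * t + k * (n + 1) \<le> 3 * k * k"
begin

lemma four_t: "4 * real t \<le> real k * (3 * real k - real n - 1)"
proof -
  have "real (4 * t + k * (n + 1)) \<le> real (3 * k * k)" using few by (rule of_nat_mono)
  then show ?thesis by (simp add: algebra_simps)
qed

lemma n_large': "1000000000 \<le> n" using n_large by simp

definition heavy :: "'a \<Rightarrow> 'a set" where
  "heavy x = {y \<in> nb x. 3 * k \<le> n + 3 * card (nb x \<inter> nb y)}"

text \<open>The sum of the codegrees over ordered edges is \<open>6 * t\<close>, and each heavy one
  contributes at least \<open>(3k - n)/3\<close>.\<close>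

lemma heavy_sum: "2 * (\<Sum>x\<in>V. card (heavy x)) \<le> 9 * k"
proof -
  have pos: "0 < 3 * k - n" using k_lower by simp
  have "card (heavy x) * (3 * k - n) \<le> 3 * (\<Sum>y\<in>nb x. card (nb x \<inter> nb y))" for x
  proof -
    have "card (heavy x) * (3 * k - n) \<le> (\<Sum>y\<in>heavy x. 3 * card (nb x \<inter> nb y))"
      by (rule sum_bounded_below[where 'a = nat, simplified]) (auto simp: heavy_def)
    also have "\<dots> \<le> (\<Sum>y\<in>nb x. 3 * card (nb x \<inter> nb y))"
      using fin_nb by (intro sum_mono2) (auto simp: heavy_def)
    finally show ?thesis by (simp add: sum_distrib_left)
  qed
  then have "(\<Sum>x\<in>V. card (heavy x) * (3 * k - n)) \<le> (\<Sum>x\<in>V. 3 * (\<Sum>y\<in>nb x. card (nb x \<inter> nb y)))"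
    by (intro sum_mono)
  then have "(\<Sum>x\<in>V. card (heavy x)) * (3 * k - n) \<le> 18 * t"
    by (simp add: sum_distrib_right sum_distrib_left[symmetric] codegree_sum)
  moreover have "4 * t \<le> k * (3 * k - n)"
  proof -
    have "k * (3 * k - n) = 3 * k * k - k * n" by (simp add: diff_mult_distrib2)
    then show ?thesis using few by (simp add: algebra_simps)
  qed
  ultimately have "2 * (\<Sum>x\<in>V. card (heavy x)) * (3 * k - n) \<le> 9 * k * (3 * k - n)"
    by linarith
  then show ?thesis using pos by simp
qed

text \<open>The threshold \<open>n/1100\<close> stays below \<open>n/1000\<close>: a vertex outside
  \<open>L\<close> loses fewer than \<open>n/1100\<close> heavy neighbours and at most 2475 vertices
  of \<open>L\<close>, together at most \<open>n div 1000\<close>.\<close>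

definition L :: "'a set" where "L = {x \<in> V. n \<le> 1100 * card (heavy x)}"

lemma card_L: "card L \<le> 2475"
proof -
  have "card L * n \<le> (\<Sum>x\<in>L. 1100 * card (heavy x))"
    by (rule sum_bounded_below[where 'a = nat, simplified]) (auto simp: L_def)
  also have "\<dots> \<le> (\<Sum>x\<in>V. 1100 * card (heavy x))"
    using fin_V by (intro sum_mono2) (auto simp: L_def)
  also have "\<dots> \<le> 4950 * k" using heavy_sum by (simp add: sum_distrib_left[symmetric])
  also have "\<dots> \<le> 2475 * n" using k_upper by simp
  finally show ?thesis using n_large by simp
qed

definition W :: "'a set" where "W = V - L"

definition light :: "'a \<Rightarrow> 'a set" where "light x = (nb x - heavy x) \<inter> W"

definition D :: nat where "D = k - n div 1000"

sublocale light: triangle_free_dense W light n D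
proof
  show "finite W" using fin_V by (simp add: W_def)
  show "card W \<le> n" using card_V fin_V by (auto simp: W_def intro: card_mono)
  show "light x \<subseteq> W" for x by (auto simp: light_def)
  show "x \<in> light y" if "x \<in> W" "y \<in> light x" for x y
    using that nb_sym[of y x] by (auto simp: light_def heavy_def Int_commute)
  \<comment> \<open>The codegrees of three vertices sum to at least \<open>3k - n\<close>, while
    those of three light edges sum to less.\<close>
  show "light x \<inter> light y = {}" if "x \<in> W" "y \<in> light x" for x y
  proof (rule ccontr)
    assume "light x \<inter> light y \<noteq> {}"
    then obtain z where z: "z \<in> light x" "z \<in> light y" by blast
    have "x \<in> V" "y \<in> V" "z \<in> V" using that z by (auto simp: light_def W_def)
    then have "3 * k \<le> n + card (nb x \<inter> nb y) + card (nb y \<inter> nb z) + card (nb x \<inter> nb z)"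
      using three_sets_card_le[OF fin_V nb_sub nb_sub nb_sub, of x y z] card_nb card_V by simp
    moreover have "n + 3 * card (nb x \<inter> nb y) < 3 * k" "n + 3 * card (nb y \<inter> nb z) < 3 * k"
      "n + 3 * card (nb x \<inter> nb z) < 3 * k"
      using that z by (auto simp: light_def heavy_def)
    ultimately show False by linarith
  qed
  show "D \<le> card (light x)" if x: "x \<in> W" for x
  proof -
    have "nb x \<subseteq> light x \<union> (heavy x \<union> L)" using nb_sub by (auto simp: light_def W_def)
    then have "card (nb x) \<le> card (light x \<union> (heavy x \<union> L))"
      using fin_nb fin_V by (intro card_mono) (auto simp: light_def heavy_def L_def)
    also have "\<dots> \<le> card (light x) + (card (heavy x) + card L)"
      by (metis add_left_mono card_Un_le order_trans)
    finally have "k \<le> card (light x) + (card (heavy x) + card L)"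
      using card_nb x by (simp add: W_def)
    moreover have "1100 * card (heavy x) < n" using x by (auto simp: W_def L_def)
    moreover have "n < 1000 * (n div 1000) + 1000"
      using div_mult_mod_eq[of n 1000] mod_less_divisor[of 1000 n] by linarith
    moreover have "1000000000 \<le> n" using n_large by simp
    ultimately show ?thesis unfolding D_def using card_L by linarith
  qed
qed

text \<open>The codegree is the weight in \<open>closed_walk5_weight\<close>. A walk forces
  \<open>k\<close> to be at most \<open>0.401 n\<close>; then \<open>4m^2 - 20ms\<close> exceeds
  \<open>0.127 n^2\<close>, whereas the total weight \<open>6t\<close> is below
  \<open>0.123 n^2\<close>.\<close>

lemma no_light_closed_walk5:
  assumes "a \<in> W" shows "\<not> closed_walk5 light a b c d e"
proof
  assume walk: "closed_walk5 light a b c d e"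
  let ?w = "\<lambda>x y. card (nb x \<inter> nb y)"
  have le: "5 * D \<le> 2 * n" using light.five_D_le[OF assms walk] .
  have D: "real D = real k - real (n div 1000)" unfolding D_def using k_lower by simp
  have n1000: "real (n div 1000) \<le> real n / 1000" using of_nat_div_le_of_nat[of n 1000, where 'a = real] by simp
  have kD: "real k \<le> 401 / 1000 * real n" and D_ge: "399 / 1000 * real n \<le> real D"
    using D n1000 le k_lower by linarith+
  define m where "m = 8 * D - 3 * n"
  define s where "s = 2 * n - 5 * D"
  have m: "real m = 8 * real D - 3 * real n" and s: "real s = 2 * real n - 5 * real D"
    using D_ge le by (auto simp: m_def s_def)
  have "0 < m" using m D_ge n_large by simp
  have "4 * m * m \<le> (\<Sum>x\<in>W. \<Sum>y\<in>light x. ?w x y) + 20 * m * s"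
  proof (rule light.closed_walk5_weight[OF assms walk])
    fix x0 x1 x2 x3 x4 assume x: "x0 \<in> W" "closed_walk5 light x0 x1 x2 x3 x4"
    have "x0 \<in> V" "x1 \<in> V" "x2 \<in> V" "x3 \<in> V" "x4 \<in> V"
      using x by (auto simp: closed_walk5_def light_def W_def)
    then have "5 * k \<le> 2 * n + (?w x0 x1 + ?w x1 x2 + ?w x2 x3 + ?w x3 x4 + ?w x4 x0)"
      using five_sets_card_le[OF fin_V nb_sub nb_sub nb_sub nb_sub nb_sub, of x0 x1 x2 x3 x4]
        card_nb card_V by simp
    \<comment> \<open>\<open>5k - 2n\<close> is positive, and even because \<open>k\<close>
      is.\<close>
    moreover have "2 * n + 2 \<le> 5 * k" using k_lower even_k by presburger
    ultimately show "2 \<le> ?w x0 x1 + ?w x1 x2 + ?w x2 x3 + ?w x3 x4 + ?w x4 x0" by linarith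
  qed (use \<open>0 < m\<close> in \<open>auto simp: m_def s_def Int_commute\<close>)
  also have "(\<Sum>x\<in>W. \<Sum>y\<in>light x. ?w x y) \<le> (\<Sum>x\<in>V. \<Sum>y\<in>nb x. ?w x y)"
  proof -
    have "(\<Sum>x\<in>W. \<Sum>y\<in>light x. ?w x y) \<le> (\<Sum>x\<in>W. \<Sum>y\<in>nb x. ?w x y)"
      using fin_nb by (intro sum_mono sum_mono2) (auto simp: light_def)
    also have "\<dots> \<le> (\<Sum>x\<in>V. \<Sum>y\<in>nb x. ?w x y)"
      using fin_V by (intro sum_mono2) (auto simp: W_def)
    finally show ?thesis .
  qed
  finally have "4 * m * m \<le> 6 * t + 20 * m * s" by (simp add: codegree_sum)
  then have "real (4 * m * m) \<le> real (6 * t + 20 * m * s)" by (rule of_nat_mono)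
  then have main: "4 * (real m * real m) \<le> 6 * real t + 20 * (real m * real s)" by simp
  have "4 * real t \<le> real k * (3 * real k - real n)"
    using four_t by (simp add: algebra_simps)
  also have "\<dots> \<le> (401 / 1000 * real n) * (203 / 1000 * real n)"
    using kD k_lower by (intro mult_mono) auto
  finally have t': "real t \<le> 81403 / 4000000 * (real n * real n)" by simp
  have m_ge: "192 / 1000 * real n \<le> real m" and m_le: "real m \<le> 200 / 1000 * real n"
    and s_le: "real s \<le> 5 / 1000 * real n"
    using m s D_ge le by linarith+
  have "(192 / 1000 * real n) * (192 / 1000 * real n) \<le> real m * real m"
    using m_ge by (intro mult_mono) auto
  moreover have "real m * real s \<le> (200 / 1000 * real n) * (5 / 1000 * real n)"
    using m_le s_le by (intro mult_mono) auto
  moreover have "0 < real n * real n" using n_large by simp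
  ultimately show False using main t' by simp
qed

text \<open>The vertices of \<open>L\<close> join the side \<open>V - P\<close>. Counting ordered
  edges, heavy ones contribute at most \<open>9k/2\<close>, and those into \<open>L\<close> and out
  of \<open>L\<close> at most \<open>2475k\<close> each.\<close>

lemma ex_partition_few_inner:
  "\<exists>P\<subseteq>V. inner P + inner (V - P) \<le> 4955 * k"
proof -
  have "n < 3 * D"
  proof -
    have "n div 1000 \<le> n" by simp
    then show ?thesis unfolding D_def using k_lower n_large by linarith
  qed
  then obtain P where P: "P \<subseteq> W" "\<And>x. x \<in> P \<Longrightarrow> light x \<inter> P = {}"
      "\<And>x. x \<in> W - P \<Longrightarrow> light x \<inter> (W - P) = {}"
    using light.bipartite_if_no_closed_walk5 no_light_closed_walk5 by metis
  have fh: "finite (heavy x)" for x using fin_nb by (simp add: heavy_def)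
  have fL: "finite L" using fin_V by (simp add: L_def)
  have LV: "L \<subseteq> V" and PV: "P \<subseteq> V" using P by (auto simp: L_def W_def)
  have inP: "card (nb x \<inter> P) \<le> card (heavy x)" if "x \<in> P" for x
    using P that by (intro card_mono fh) (auto simp: light_def)
  have inW: "card (nb x \<inter> (V - P)) \<le> card (heavy x) + card (nb x \<inter> L)" if "x \<in> W - P" for x
  proof -
    have "nb x \<inter> (V - P) \<subseteq> heavy x \<union> (nb x \<inter> L)"
      using P(3)[OF that] by (auto simp: light_def W_def)
    then show ?thesis using fh fL by (meson card_Un_le card_mono finite_Int finite_UnI order_trans)
  qed
  have inL: "card (nb x \<inter> (V - P)) \<le> k" if "x \<in> L" for x
    using card_mono[OF fin_nb, of "nb x \<inter> (V - P)" x] card_nb that LV by auto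
  have VP: "V - P = (W - P) \<union> L" "(W - P) \<inter> L = {}" using P LV by (auto simp: W_def)
  have fW: "finite (W - P)" "finite P" using fin_V PV finite_subset by (auto simp: W_def)
  have "inner (V - P) = (\<Sum>x\<in>W - P. card (nb x \<inter> (V - P))) + (\<Sum>x\<in>L. card (nb x \<inter> (V - P)))"
    unfolding inner_def using VP fW fL by (metis sum.union_disjoint)
  also have "\<dots> \<le> (\<Sum>x\<in>W - P. card (heavy x) + card (nb x \<inter> L)) + (\<Sum>x\<in>L. k)"
    using inW inL by (intro add_mono sum_mono) auto
  finally have a: "inner (V - P) \<le> (\<Sum>x\<in>W - P. card (heavy x)) + (\<Sum>x\<in>W - P. card (nb x \<inter> L)) + card L * k"
    by (simp add: sum.distrib)
  have b: "inner P \<le> (\<Sum>x\<in>P. card (heavy x))"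
    unfolding inner_def using inP by (intro sum_mono)
  have "(\<Sum>x\<in>W - P. card (heavy x)) + (\<Sum>x\<in>P. card (heavy x)) = (\<Sum>x\<in>W - P \<union> P. card (heavy x))"
    using fW by (intro sum.union_disjoint[symmetric]) auto
  also have "\<dots> \<le> (\<Sum>x\<in>V. card (heavy x))"
    using PV fin_V by (intro sum_mono2) (auto simp: W_def)
  finally have c: "2 * (\<Sum>x\<in>W - P. card (heavy x)) + 2 * (\<Sum>x\<in>P. card (heavy x)) \<le> 9 * k"
    using heavy_sum by simp
  have "(\<Sum>x\<in>W - P. card (nb x \<inter> L)) = (\<Sum>y\<in>L. card (nb y \<inter> (W - P)))"
    using cross_count fW fL by blast
  also have "\<dots> \<le> (\<Sum>y\<in>L. k)"
    using LV card_nb fin_nb by (intro sum_mono) (metis card_mono inf_le1 subsetD)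
  finally have d: "(\<Sum>x\<in>W - P. card (nb x \<inter> L)) \<le> card L * k" by simp
  have "card L * k \<le> 2475 * k" using card_L by simp
  with a b c d have "inner P + inner (V - P) \<le> 4955 * k" by linarith
  with PV show ?thesis by blast
qed

text \<open>A maximum cut minimises the number of inner edges, since inner degrees plus twice the
  cut make \<open>n * k\<close>; so it inherits the bound of the previous partition. Its sides
  differ in size because \<open>n\<close> is odd.\<close>

lemma ex_good_partition:
  obtains X Y where "X \<union> Y = V" "X \<inter> Y = {}" "card Y < card X" "inner X + inner Y \<le> 4955 * k"
    "\<And>x. x \<in> X \<Longrightarrow> 2 * card (nb x \<inter> X) \<le> k" "\<And>y. y \<in> Y \<Longrightarrow> 2 * card (nb y \<inter> Y) \<le> k"
    "inner X + card Y * k = inner Y + card X * k"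
proof -
  have fin: "finite (cut ` Pow V)" using fin_V by auto
  then have "Max (cut ` Pow V) \<in> cut ` Pow V" by (intro Max_in) auto
  then obtain S where "S \<in> Pow V" "cut S = Max (cut ` Pow V)" by auto
  then have S: "S \<in> Pow V" "\<And>S'. S' \<in> Pow V \<Longrightarrow> cut S' \<le> cut S"
    using Max_ge[OF fin] by auto
  have S_inner: "inner S + inner (V - S) \<le> 4955 * k"
  proof -
    obtain P where P: "P \<subseteq> V" "inner P + inner (V - P) \<le> 4955 * k"
      using ex_partition_few_inner by blast
    have eq: "inner T + inner (V - T) + 2 * cut T = n * k" if "T \<subseteq> V" for T
    proof -
      have "card T + card (V - T) = n"
        using that fin_V card_V by (metis card_Diff_subset card_mono finite_subset le_add_diff_inverse)
      moreover have "inner T + cut T + (inner (V - T) + cut T) = (card T + card (V - T)) * k"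
        using inner_plus_cut[OF that] inner_plus_cut[of "V - T"] cut_compl[OF that]
        by (simp add: add_mult_distrib)
      ultimately show ?thesis by simp
    qed
    have "cut P \<le> cut S" using S P by simp
    then show ?thesis using eq[of S] eq[of P] P S(1) by simp
  qed
  have deg: "2 * card (nb x \<inter> S) \<le> k" if "x \<in> S" for x
    using max_cut_inner_degree[of S x] S that by auto
  have deg': "2 * card (nb x \<inter> (V - S)) \<le> k" if "x \<in> V - S" for x
    using max_cut_inner_degree[of "V - S" x] S that by (auto simp: cut_compl)
  have bal: "inner S + card (V - S) * k = inner (V - S) + card S * k"
    using inner_plus_cut[of S] inner_plus_cut[of "V - S"] cut_compl[of S] S by auto
  have "card S + card (V - S) = n"
    using S fin_V card_V by (metis PowD card_Diff_subset card_mono finite_subset le_add_diff_inverse)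
  then have "card S \<noteq> card (V - S)" using odd_n by auto
  then consider "card (V - S) < card S" | "card S < card (V - S)" by linarith
  then show thesis
  proof cases
    case 1
    show thesis by (rule that[of S "V - S"]) (use 1 S S_inner deg deg' bal in auto)
  next
    case 2
    show thesis by (rule that[of "V - S" S]) (use 2 S S_inner deg deg' bal in auto)
  qed
qed

end

section \<open>Edges inside the parts of a maximum cut\<close>

context regular_graph_on
begin

text \<open>Inclusion-exclusion for the neighbours of \<open>x\<close> and \<open>y\<close> in
  \<open>V - S\<close>; equality holds only if they cover \<open>V - S\<close>.\<close>

lemma card_opposite_ge:
  assumes S: "S \<subseteq> V" and "x \<in> V" "y \<in> V"
  shows "2 * k \<le> card (nb x \<inter> nb y - S) + card (nb x \<inter> S) + card (nb y \<inter> S) + card (V - S)"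
    and "2 * k = card (nb x \<inter> nb y - S) + card (nb x \<inter> S) + card (nb y \<inter> S) + card (V - S)
      \<Longrightarrow> V - S \<subseteq> nb x \<union> nb y"
proof -
  have "card (nb x \<inter> S) + card (nb x - S) = k" "card (nb y \<inter> S) + card (nb y - S) = k"
    using card_Int_Diff[OF fin_nb, of x S] card_Int_Diff[OF fin_nb, of y S] card_nb assms by auto
  moreover have "card (nb x - S) + card (nb y - S)
      = card ((nb x - S) \<union> (nb y - S)) + card ((nb x - S) \<inter> (nb y - S))"
    using fin_nb by (intro card_Un_Int) auto
  moreover have "(nb x - S) \<inter> (nb y - S) = nb x \<inter> nb y - S" by auto
  ultimately have eq: "2 * k + card (V - S) = card (nb x \<inter> nb y - S) + card (nb x \<inter> S) + card (nb y \<inter> S)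
      + card (V - S) + card ((nb x - S) \<union> (nb y - S))"
    by simp
  have sub: "(nb x - S) \<union> (nb y - S) \<subseteq> V - S" using nb_sub by auto
  have fin: "finite (V - S)" using fin_V by simp
  show "2 * k \<le> card (nb x \<inter> nb y - S) + card (nb x \<inter> S) + card (nb y \<inter> S) + card (V - S)"
    using eq card_mono[OF fin sub] by linarith
  assume "2 * k = card (nb x \<inter> nb y - S) + card (nb x \<inter> S) + card (nb y \<inter> S) + card (V - S)"
  then have "card ((nb x - S) \<union> (nb y - S)) = card (V - S)" using eq by linarith
  then show "V - S \<subseteq> nb x \<union> nb y" using card_subset_eq[OF fin sub] by auto
qed

text \<open>Among the inner edges at \<open>x\<close> or \<open>y\<close> only \<open>xy\<close> is
  counted twice; \<open>inner S\<close> is twice the number of inner edges.\<close>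

lemma inner_degree_pair_le:
  assumes S: "S \<subseteq> V" and x: "x \<in> S" and y: "y \<in> nb x \<inter> S"
  shows "2 * card (nb x \<inter> S) + 2 * card (nb y \<inter> S) \<le> inner S + 2"
proof -
  have fin: "finite S" using S fin_V finite_subset by blast
  have xy: "x \<noteq> y" using y not_nb_self by auto
  let ?T = "S - {x} - {y}"
  have fT: "finite ?T" using fin by simp
  have *: "(\<Sum>z\<in>?T. card (nb z \<inter> {x, y})) = card (nb x \<inter> ?T) + card (nb y \<inter> ?T)"
    using cross_count[OF fT, of "{x, y}"] xy by simp
  have "nb x \<inter> S = insert y (nb x \<inter> ?T)" using y not_nb_self[of x] by auto
  then have "card (nb x \<inter> S) = Suc (card (nb x \<inter> ?T))" using fT by simp
  moreover have "nb y \<inter> S = insert x (nb y \<inter> ?T)" using x y nb_sym not_nb_self[of y] by auto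
  then have "card (nb y \<inter> S) = Suc (card (nb y \<inter> ?T))" using fT by simp
  moreover have "(\<Sum>z\<in>?T. card (nb z \<inter> {x, y})) \<le> (\<Sum>z\<in>?T. card (nb z \<inter> S))"
    using x y fin by (intro sum_mono card_mono) auto
  moreover have "inner S = card (nb x \<inter> S) + (card (nb y \<inter> S) + (\<Sum>z\<in>?T. card (nb z \<inter> S)))"
    unfolding inner_def using x y xy fin
      sum.remove[of S x "\<lambda>z. card (nb z \<inter> S)"] sum.remove[of "S - {x}" y "\<lambda>z. card (nb z \<inter> S)"]
    by simp
  ultimately show ?thesis using * by linarith
qed

end

text \<open>The parts of a maximum cut, the larger one being \<open>X\<close>.\<close>

locale good_partition = few_triangles +
  fixes X Y :: "'a set"
  assumes X_Un_Y: "X \<union> Y = V" and X_Int_Y: "X \<inter> Y = {}" and card_less: "card Y < card X"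
    and few_inner: "inner X + inner Y \<le> 4955 * k"
    and inner_degree_X: "x \<in> X \<Longrightarrow> 2 * card (nb x \<inter> X) \<le> k"
    and inner_degree_Y: "y \<in> Y \<Longrightarrow> 2 * card (nb y \<inter> Y) \<le> k"
    and balance: "inner X + card Y * k = inner Y + card X * k"
begin

definition side :: "'a \<Rightarrow> 'a set" where "side x = (if x \<in> X then X else Y)"

definition d :: "'a \<Rightarrow> nat" where "d x = card (nb x \<inter> side x)"

text \<open>For an inner edge \<open>xy\<close>, the number of triangles on it with apex on the
  other side.\<close>

definition opp :: "'a \<Rightarrow> 'a \<Rightarrow> nat" where "opp x y = card (nb x \<inter> nb y - side x)"

lemma XY: "X \<subseteq> V" "Y \<subseteq> V" "finite X" "finite Y" "V - X = Y" "V - Y = X" "card X + card Y = n"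
proof -
  show XV: "X \<subseteq> V" "Y \<subseteq> V" "V - X = Y" "V - Y = X" using X_Un_Y X_Int_Y by auto
  then show fin: "finite X" "finite Y" using fin_V finite_subset by auto
  then show "card X + card Y = n" using card_Un_disjoint[OF fin X_Int_Y] X_Un_Y card_V by simp
qed

lemma sum_V: "(\<Sum>x\<in>V. f x) = (\<Sum>x\<in>X. f x) + (\<Sum>x\<in>Y. f x :: nat)"
  using sum.union_disjoint[OF XY(3,4) X_Int_Y, of f] X_Un_Y by simp

lemma side_Y: "x \<in> Y \<Longrightarrow> side x = Y" and side_X: "x \<in> X \<Longrightarrow> side x = X"
  using X_Int_Y by (auto simp: side_def)

lemma sum_d: "(\<Sum>x\<in>V. d x) = inner X + inner Y"
  by (simp add: sum_V d_def inner_def side_X side_Y)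

lemma two_d_le: "x \<in> V \<Longrightarrow> 2 * d x \<le> k"
  using inner_degree_X inner_degree_Y X_Un_Y side_X side_Y unfolding d_def by fastforce

text \<open>A triangle meeting both sides has exactly one inner edge, so two of its six orderings
  begin with that edge. \<open>A1\<close>, \<open>A2\<close>, \<open>A3\<close> sort the orderings
  by the positions of this edge.\<close>

lemma sum_opp_le: "(\<Sum>x\<in>V. \<Sum>y\<in>nb x \<inter> side x. opp x y) \<le> 2 * t"
proof -
  let ?s = "\<lambda>x y. x \<in> X \<longleftrightarrow> y \<in> X"
  define A1 where "A1 = {(x, y, z) \<in> ordered_triangles. ?s x y \<and> \<not> ?s x z}"
  define A2 where "A2 = {(x, y, z) \<in> ordered_triangles. ?s x z \<and> \<not> ?s x y}"
  define A3 where "A3 = {(x, y, z) \<in> ordered_triangles. ?s y z \<and> \<not> ?s x y}"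
  have fin: "finite A1" "finite A2" "finite A3"
    by (rule finite_subset[OF _ fin_ordered_triangles]; auto simp: A1_def A2_def A3_def)+
  have "A2 = (\<lambda>(x, y, z). (x, z, y)) ` A1"
    by (auto simp: A1_def A2_def ordered_triangles_def image_iff intro: nb_sym)
  moreover have "A3 = (\<lambda>(x, y, z). (z, x, y)) ` A1"
    by (auto simp: A1_def A3_def ordered_triangles_def image_iff intro: nb_sym)
  moreover have "inj_on (\<lambda>(x, y, z). (x, z, y)) A1" "inj_on (\<lambda>(x, y, z). (z, x, y)) A1"
    by (auto simp: inj_on_def)
  ultimately have "card A2 = card A1" "card A3 = card A1" by (simp_all add: card_image)
  moreover have "card (A1 \<union> (A2 \<union> A3)) = card A1 + (card A2 + card A3)"
  proof -
    have "A2 \<inter> A3 = {}" "A1 \<inter> (A2 \<union> A3) = {}" by (auto simp: A1_def A2_def A3_def)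
    then show ?thesis using fin by (simp add: card_Un_disjoint)
  qed
  moreover have "card (A1 \<union> (A2 \<union> A3)) \<le> card ordered_triangles"
    by (intro card_mono fin_ordered_triangles) (auto simp: A1_def A2_def A3_def)
  ultimately have "card A1 \<le> 2 * t" by (simp add: card_ordered_triangles)
  moreover have "A1 = (SIGMA x:V. SIGMA y:nb x \<inter> side x. nb x \<inter> nb y - side x)"
  proof -
    have "x \<in> V" "y \<in> V" if "y \<in> nb x" for x y using that nb_in nb_sub by auto
    then have "y \<in> side x \<longleftrightarrow> ?s x y" if "y \<in> nb x" for x y
      using that X_Un_Y X_Int_Y by (auto simp: side_def)
    then show ?thesis using nb_in by (auto simp: A1_def ordered_triangles_def)
  qed
  ultimately show ?thesis using fin_V fin_nb by (simp add: opp_def)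
qed

lemma opp_ge:
  assumes "y \<in> nb x \<inter> side x"
  shows "2 * k \<le> opp x y + d x + d y + card (V - side x)"
proof -
  have "side y = side x" using assms X_Int_Y by (auto simp: side_def split: if_splits)
  moreover have "x \<in> V" "y \<in> V" using assms nb_in nb_sub by auto
  ultimately show ?thesis
    using card_opposite_ge(1)[of "side x" x y] XY by (simp add: opp_def d_def side_def)
qed

text \<open>An inner edge with an end outside \<open>big\<close> has a small degree sum and hence
  many apexes. Edges within \<open>big\<close> are few, as \<open>big\<close> turns out to have at
  most 24 elements.\<close>

definition big :: "'a set" where "big = {x \<in> V. n \<le> 30 * d x}"

definition arcs :: "('a \<times> 'a) set" where "arcs = (SIGMA x:V. nb x \<inter> side x)"

lemma fin_arcs: "finite arcs"
  unfolding arcs_def using fin_V fin_nb by auto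

lemma card_arcs: "card arcs = inner X + inner Y"
  unfolding arcs_def using fin_V fin_nb by (simp add: d_def[symmetric] sum_d)

lemma card_arcs_not_big: "5 * card (arcs - big \<times> big) \<le> 8 * k"
proof -
  let ?J = "arcs - big \<times> big"
  have kpos: "0 < k" using k_lower n_large' by simp
  have "(card X - card Y) * k \<le> 4955 * k"
    using balance few_inner card_less by (simp add: diff_mult_distrib)
  then have "card X \<le> card Y + 4955" using kpos by simp
  then have X_le: "2 * card X \<le> n + 4955" using XY by simp
  \<comment> \<open>\<open>q / 60\<close> equals \<open>2k - k/2 - n/30 - (n + 4955)/2\<close>: one
    end has inner degree below \<open>n/30\<close>, the other at most \<open>k/2\<close>, and the
    opposite side has at most \<open>(n + 4955)/2\<close> vertices.\<close>
  define q where "q = 90 * real k - 32 * real n - 148650"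
  have q: "q \<le> 60 * real (opp x y)" if "(x, y) \<in> ?J" for x y
  proof -
    have xy: "y \<in> nb x \<inter> side x" "x \<in> V" "y \<in> V" "\<not> (x \<in> big \<and> y \<in> big)"
      using that nb_sub by (auto simp: arcs_def)
    have "card (V - side x) \<le> card X" using card_less XY by (simp add: side_def)
    moreover have "2 * (30 * d x) + 2 * (30 * d y) \<le> 30 * k + 2 * n"
      using two_d_le[of x] two_d_le[of y] xy by (auto simp: big_def)
    ultimately have "120 * k \<le> 60 * opp x y + (30 * k + 2 * n) + (30 * n + 148650)"
      using opp_ge[OF xy(1)] X_le by simp
    then show ?thesis unfolding q_def by linarith
  qed
  have "real (card ?J) * q \<le> (\<Sum>(x, y)\<in>?J. 60 * real (opp x y))"
    using q by (intro sum_bounded_below) auto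
  also have "\<dots> \<le> (\<Sum>(x, y)\<in>arcs. 60 * real (opp x y))"
    using fin_arcs by (intro sum_mono2) auto
  also have "\<dots> = 60 * real (\<Sum>x\<in>V. \<Sum>y\<in>nb x \<inter> side x. opp x y)"
    unfolding arcs_def using fin_V fin_nb by (subst sum.Sigma[symmetric]) (auto simp: sum_distrib_left)
  also have "\<dots> \<le> 120 * real t" using sum_opp_le by linarith
  also have "\<dots> \<le> real k * (30 * (3 * real k - real n))" using four_t kpos by (simp add: algebra_simps)
  \<comment> \<open>This amounts to \<open>54k - 21.2n \<ge> 237840\<close>, which follows from
    \<open>k > 2n/5\<close> as \<open>n\<close> is large.\<close>
  also have "\<dots> \<le> real k * (8 / 5 * q)"
    using k_lower n_large' by (intro mult_left_mono) (auto simp: q_def)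
  finally have "real (card ?J) * q \<le> (8 / 5 * real k) * q" by simp
  moreover have "0 < q" using k_lower n_large' by (simp add: q_def)
  ultimately have "real (card ?J) \<le> 8 / 5 * real k" by simp
  then show ?thesis by linarith
qed

text \<open>The crude bound on inner edges gives \<open>card big \<le> 74325\<close>. Fed back, with
  at most \<open>card big ^ 2\<close> arcs inside \<open>big\<close> and \<open>1.6k\<close> others,
  it improves to 24. In total there are at most \<open>1.6k + 576\<close> arcs.\<close>

lemma card_arcs_le: "10 * inner X + 10 * inner Y \<le> 17 * k"
proof -
  let ?J = "arcs - big \<times> big"
  have fin: "finite big" using fin_V by (simp add: big_def)
  have n_big: "card big * n \<le> 30 * (\<Sum>x\<in>big. d x)"
  proof -
    have "card big * n \<le> (\<Sum>x\<in>big. 30 * d x)"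
      by (rule sum_bounded_below[where 'a = nat, simplified]) (auto simp: big_def)
    then show ?thesis by (simp add: sum_distrib_left)
  qed
  also have "(\<Sum>x\<in>big. d x) \<le> (\<Sum>x\<in>V. d x)"
    using fin_V by (intro sum_mono2) (auto simp: big_def)
  finally have "card big * n \<le> 148650 * k" using few_inner by (simp add: sum_d)
  also have "\<dots> \<le> 74325 * n" using k_upper by simp
  finally have b1: "card big \<le> 74325" using n_large' by simp
  have "(\<Sum>x\<in>big. d x) = card (SIGMA x:big. nb x \<inter> side x)"
    using fin fin_nb by (simp add: d_def)
  also have "\<dots> \<le> card (?J \<union> big \<times> big)"
    using fin fin_arcs by (intro card_mono) (auto simp: arcs_def big_def)
  also have "\<dots> \<le> card ?J + card big * card big"
    using card_Un_le[of ?J "big \<times> big"] by (simp add: card_cartesian_product)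
  also have "card big * card big \<le> 74325 * card big" using b1 by simp
  finally have "card big * n \<le> 30 * card ?J + 2229750 * card big" using n_big by linarith
  then have b2: "card big * n \<le> 24 * n + 2229750 * card big"
    using card_arcs_not_big k_upper by linarith
  have "card big \<le> 24"
  proof (rule ccontr)
    assume "\<not> card big \<le> 24"
    then obtain r where r: "card big = 25 + r" using le_Suc_ex[of 25 "card big"] by auto
    have "r * 2229750 \<le> r * n" using n_large' by (intro mult_left_mono) auto
    moreover have "25 * n + r * n \<le> 24 * n + (55743750 + r * 2229750)"
      using b2 unfolding r by (simp add: algebra_simps)
    ultimately show False using n_large' by linarith
  qed
  then have "card big * card big \<le> 24 * 24" by (intro mult_mono) auto
  moreover have "card arcs \<le> card ?J + card big * card big"
  proof -
    have "card arcs \<le> card (?J \<union> big \<times> big)"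
      using fin fin_arcs by (intro card_mono) auto
    then show ?thesis using card_Un_le[of ?J "big \<times> big"] by (simp add: card_cartesian_product)
  qed
  ultimately show ?thesis using card_arcs card_arcs_not_big k_lower n_large' by linarith
qed

text \<open>The inner degree sums differ by \<open>(card X - card Y) * k\<close>, and a difference
  of \<open>2k\<close> would exceed the bound \<open>1.7k\<close>.\<close>

lemma card_X: "card X = card Y + 1" and inner_X: "inner X = inner Y + k"
proof -
  obtain r where r: "card X = card Y + 1 + r" using card_less less_iff_Suc_add by auto
  have eq: "inner X = inner Y + k + r * k" using balance unfolding r by (simp add: algebra_simps)
  have "r = 0"
  proof (rule ccontr)
    assume "r \<noteq> 0"
    then have "k \<le> r * k" by simp
    then show False using eq card_arcs_le k_lower n_large' by linarith
  qed
  then show "card X = card Y + 1" "inner X = inner Y + k" using r eq by auto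
qed

text \<open>An inner edge \<open>xy\<close> of \<open>X\<close> lies in at least \<open>2k - d(x) - d(y) - |Y|\<close> triangles with apex in \<open>Y\<close>, and
  \<open>d(x) + d(y)\<close> exceeds the number of inner edges of \<open>X\<close> by at most 1. Summing over the inner
  edges of both parts gives \<open>4t \<ge> k(3k - n - 1) + i(6k - 2n - 4 - 2i)\<close>, where \<open>i = inner Y\<close>.\<close>

lemma equality_case:
  shows "inner Y = 0" and "4 * real t = real k * (3 * real k - real n - 1)"
    and "\<And>x y. x \<in> X \<Longrightarrow> y \<in> nb x \<inter> X \<Longrightarrow>
      2 * card (nb x \<inter> X) + 2 * card (nb y \<inter> X) = k + 2 \<and> Y \<subseteq> nb x \<union> nb y"
proof -
  define i where "i = real (inner Y)"
  have iX: "real (inner X) = real k + i" using inner_X by (simp add: i_def)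
  have n: "real n = 2 * real (card Y) + 1" using XY card_X by simp
  have fX: "real (\<Sum>x\<in>X. \<Sum>y\<in>nb x \<inter> X. f x y) = (\<Sum>(x, y)\<in>(SIGMA x:X. nb x \<inter> X). real (f x y))" for f
    using XY fin_nb by (subst sum.Sigma[symmetric]) auto
  have fY: "real (\<Sum>x\<in>Y. \<Sum>y\<in>nb x \<inter> Y. f x y) = (\<Sum>(x, y)\<in>(SIGMA x:Y. nb x \<inter> Y). real (f x y))" for f
    using XY fin_nb by (subst sum.Sigma[symmetric]) auto
  have cX: "real (card (SIGMA x:X. nb x \<inter> X)) = real k + i"
    using XY fin_nb iX by (simp add: inner_def)
  have cY: "real (card (SIGMA x:Y. nb x \<inter> Y)) = i"
    using XY fin_nb by (simp add: inner_def i_def)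
  let ?oX = "\<Sum>(x, y)\<in>(SIGMA x:X. nb x \<inter> X). real (opp x y)"
  let ?oY = "\<Sum>(x, y)\<in>(SIGMA x:Y. nb x \<inter> Y). real (opp x y)"
  have o: "?oX + ?oY \<le> 2 * real t"
  proof -
    have "(\<Sum>x\<in>X. \<Sum>y\<in>nb x \<inter> X. opp x y) + (\<Sum>x\<in>Y. \<Sum>y\<in>nb x \<inter> Y. opp x y) \<le> 2 * t"
      using sum_opp_le by (simp add: sum_V side_X side_Y)
    then show ?thesis using fX[of opp] fY[of opp] by linarith
  qed
  let ?q = "(3 * real k - real n - 1 - i) / 2"
  have oppX: "2 * opp x y + 2 * d x + 2 * d y + 2 * card Y \<ge> 4 * k \<and> 2 * d x + 2 * d y \<le> inner X + 2"
    if "x \<in> X" "y \<in> nb x \<inter> X" for x y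
    using opp_ge[of y x] inner_degree_pair_le[of X x y] that XY
    by (simp add: side_X d_def)
  have geX: "?q \<le> real (opp x y)" if "x \<in> X" "y \<in> nb x \<inter> X" for x y
    using oppX[OF that] iX n by (simp add: field_simps)
  have geY: "(4 * real k - real n - 3 - i) / 2 \<le> real (opp x y)" if "x \<in> Y" "y \<in> nb x \<inter> Y" for x y
  proof -
    have "2 * opp x y + 2 * d x + 2 * d y + 2 * card X \<ge> 4 * k" "2 * d x + 2 * d y \<le> inner Y + 2"
      using opp_ge[of y x] inner_degree_pair_le[of Y x y] that XY
      by (simp_all add: side_Y d_def)
    then show ?thesis using n card_X by (simp add: field_simps i_def)
  qed
  have X1: "(real k + i) * ?q \<le> ?oX"
    unfolding cX[symmetric] using geX by (intro sum_bounded_below) auto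
  have Y1: "i * ((4 * real k - real n - 3 - i) / 2) \<le> ?oY"
  proof -
    have "real (card (SIGMA x:Y. nb x \<inter> Y)) * ((4 * real k - real n - 3 - i) / 2) \<le> ?oY"
      using geY by (intro sum_bounded_below) auto
    then show ?thesis by (simp only: cY)
  qed
  have "2 * ((real k + i) * ?q) + 2 * (i * ((4 * real k - real n - 3 - i) / 2)) \<le> 4 * real t"
    using X1 Y1 o by linarith
  then have t1: "real k * (3 * real k - real n - 1) + i * (6 * real k - 2 * real n - 4 - 2 * i) \<le> 4 * real t"
    by (simp add: field_simps)
  \<comment> \<open>As \<open>inner X = i + k\<close>, the bound \<open>1.7k\<close> gives
    \<open>i \<le> 0.35k\<close>, so the expression is at least
    \<open>5.3k - 2n - 4\<close>.\<close>
  have pos: "0 < 6 * real k - 2 * real n - 4 - 2 * i"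
    using card_arcs_le inner_X k_lower n_large' by (simp add: i_def)
  have "0 \<le> i" by (simp add: i_def)
  then have i0: "i = 0"
    using t1 four_t pos by (smt (verit) mult_pos_pos)
  then show "inner Y = 0" by (simp add: i_def)
  show t: "4 * real t = real k * (3 * real k - real n - 1)" using t1 four_t i0 by simp
  fix x y assume xy: "x \<in> X" "y \<in> nb x \<inter> X"
  \<comment> \<open>The excesses \<open>opp x y - ?q\<close> are nonnegative and their sum is at
    most 0, so each of them vanishes.\<close>
  have "?oX \<le> real k * ?q" using o Y1 t i0 by simp
  moreover have "(\<Sum>p\<in>(SIGMA x:X. nb x \<inter> X). case p of (x, y) \<Rightarrow> real (opp x y) - ?q) = ?oX - real k * ?q"
    using cX i0 by (simp add: case_prod_unfold sum_subtractf)
  moreover have "real (opp x y) - ?q \<le> (\<Sum>p\<in>(SIGMA x:X. nb x \<inter> X). case p of (x, y) \<Rightarrow> real (opp x y) - ?q)"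
    using member_le_sum[of "(x, y)" "SIGMA x:X. nb x \<inter> X" "\<lambda>p. case p of (x, y) \<Rightarrow> real (opp x y) - ?q"]
      xy geX XY fin_nb by auto
  ultimately have "real (opp x y) = ?q" using geX[OF xy] by linarith
  then have opp: "2 * real (opp x y) = 3 * real k - real n - 1" using i0 by simp
  then have sum: "2 * d x + 2 * d y = k + 2" and eq: "2 * k = opp x y + d x + d y + card Y"
    using oppX[OF xy] inner_X \<open>inner Y = 0\<close> n by linarith+
  have "d x = card (nb x \<inter> X)" "d y = card (nb y \<inter> X)" "opp x y = card (nb x \<inter> nb y - X)"
    using xy by (auto simp: d_def opp_def side_X)
  then show "2 * card (nb x \<inter> X) + 2 * card (nb y \<inter> X) = k + 2 \<and> Y \<subseteq> nb x \<union> nb y"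
    using sum eq card_opposite_ge(2)[of X x y] XY xy by auto
qed

end

section \<open>The extremal graphs\<close>

text \<open>Describes the two removed factors, with non-adjacency as \<open>R\<close>.\<close>

definition bipartite_edges :: "'a set \<Rightarrow> 'a set \<Rightarrow> ('a \<Rightarrow> 'a \<Rightarrow> bool) \<Rightarrow> 'a set set" where
  "bipartite_edges P Q R = {{x, y} | x y. x \<in> P \<and> y \<in> Q \<and> R x y}"

lemma mem_bipartite_edges:
  assumes "P \<inter> Q = {}" "x \<in> P"
  shows "{x, y} \<in> bipartite_edges P Q R \<longleftrightarrow> y \<in> Q \<and> R x y"
  using assms by (auto simp: bipartite_edges_def doubleton_eq_iff)

lemma regular_bipartite_edges:
  assumes fin: "finite P" "finite Q" and disj: "P \<inter> Q = {}"
    and P: "\<And>x. x \<in> P \<Longrightarrow> card {y \<in> Q. R x y} = r"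
    and Q: "\<And>y. y \<in> Q \<Longrightarrow> card {x \<in> P. R x y} = r"
  shows "regular_graph r (P \<union> Q) (bipartite_edges P Q R)"
proof -
  have simple: "simple_graph (P \<union> Q) (bipartite_edges P Q R)"
    using fin disj by (auto simp: simple_graph_def bipartite_edges_def card_insert_if)
  have "card {y. {x, y} \<in> bipartite_edges P Q R} = r" if "x \<in> P" for x
    using P[OF that] mem_bipartite_edges[OF disj that] by simp
  moreover have "card {x. {y, x} \<in> bipartite_edges P Q R} = r" if "y \<in> Q" for y
  proof -
    have "{x. {y, x} \<in> bipartite_edges P Q R} = {x \<in> P. R x y}"
      using that disj by (auto simp: bipartite_edges_def doubleton_eq_iff)
    then show ?thesis using Q[OF that] by simp
  qed
  ultimately show ?thesis
    using simple by (auto simp: regular_graph_def graph_degree_eq[OF simple])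
qed

lemma card_Diff_Int: "finite S \<Longrightarrow> card (S - T) + card (T \<inter> S) = card S"
  by (metis Int_commute add.commute card_Int_Diff)

context good_partition
begin

lemma inner_X_eq: "inner X = k"
  using inner_X equality_case(1) by simp

lemma ex_star:
  obtains v where "v \<in> X" "2 * card (nb v \<inter> X) = k" "\<And>x. x \<in> nb v \<inter> X \<Longrightarrow> nb x \<inter> X = {v}"
    "\<And>x. x \<in> X - {v} - nb v \<Longrightarrow> nb x \<inter> X = {}"
proof -
  let ?a = "\<lambda>x. card (nb x \<inter> X)"
  have fin: "finite (nb x \<inter> X)" for x using fin_nb by simp
  have k_large: "100 < k" using k_lower n_large' by simp
  \<comment> \<open>All \<open>a\<close> neighbours of \<open>x\<close> in \<open>X\<close> have inner degree \<open>k/2 + 1 - a\<close>, so the inner degree sum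
    \<open>k\<close> is at least \<open>a * (k/2 + 2 - a)\<close>, that is \<open>(a - 2) * (k - 2a) \<le> 0\<close>.\<close>
  have dichotomy: "?a x \<le> 2 \<or> 2 * ?a x = k" if x: "x \<in> X" for x
  proof (cases "?a x \<le> 2")
    case False
    have "2 * ?a x \<le> k" using inner_degree_X x by simp
    have y: "2 * ?a y = k + 2 - 2 * ?a x" if "y \<in> nb x \<inter> X" for y
      using conjunct1[OF equality_case(3)[OF x that]] by linarith
    have "?a x + (\<Sum>y\<in>nb x \<inter> X. ?a y) = (\<Sum>y\<in>insert x (nb x \<inter> X). ?a y)"
      using fin not_nb_self[of x] by simp
    also have "\<dots> \<le> inner X"
      unfolding inner_def using x XY by (intro sum_mono2) auto
    finally have "2 * ?a x + (\<Sum>y\<in>nb x \<inter> X. 2 * ?a y) \<le> 2 * k"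
      using inner_X_eq by (simp add: sum_distrib_left[symmetric])
    then have "2 * ?a x + ?a x * (k + 2 - 2 * ?a x) \<le> 2 * k"
      using y by simp
    moreover obtain m where m: "k = 2 * ?a x + m" using \<open>2 * ?a x \<le> k\<close> le_Suc_ex by blast
    moreover have "k + 2 - 2 * ?a x = m + 2" using m by linarith
    ultimately have "?a x * m \<le> 2 * m" by (simp add: algebra_simps)
    then have "m = 0" using False by simp
    then show ?thesis using m by simp
  qed simp
  have "\<exists>x\<in>X. ?a x \<noteq> 0"
  proof (rule ccontr)
    assume "\<not> ?thesis"
    then have "inner X = 0" unfolding inner_def by simp
    then show False using inner_X_eq k_large by simp
  qed
  then obtain x where x: "x \<in> X" "nb x \<inter> X \<noteq> {}" by force
  then obtain y where xy: "x \<in> X" "y \<in> nb x \<inter> X" by blast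
  \<comment> \<open>The two inner degrees sum to \<open>k/2 + 1 > 4\<close>, so they are not both at
    most 2.\<close>
  have "2 * ?a x = k \<or> 2 * ?a y = k"
    using dichotomy[of x] dichotomy[of y] equality_case(3)[OF xy] xy k_large by auto
  then obtain v where v: "v \<in> X" "2 * ?a v = k" using xy by blast
  have leaf1: "?a u = 1" if "u \<in> nb v \<inter> X" for u
    using equality_case(3)[OF v(1) that] v(2) by simp
  have leaf: "nb u \<inter> X = {v}" if "u \<in> nb v \<inter> X" for u
  proof -
    have "v \<in> nb u \<inter> X" using that v nb_sym by auto
    then show ?thesis using leaf1[OF that] by (metis card_1_singletonE singletonD)
  qed
  let ?Z = "X - {v} - nb v"
  \<comment> \<open>The centre and the leaves contribute \<open>k/2\<close> each, which exhausts
    \<open>inner X = k\<close>.\<close>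
  have "inner X = (\<Sum>u\<in>insert v (nb v \<inter> X) \<union> ?Z. ?a u)"
    unfolding inner_def using v by (intro sum.cong) auto
  also have "\<dots> = (\<Sum>u\<in>insert v (nb v \<inter> X). ?a u) + (\<Sum>u\<in>?Z. ?a u)"
    using fin XY by (intro sum.union_disjoint) auto
  also have "(\<Sum>u\<in>insert v (nb v \<inter> X). ?a u) = k"
    using fin not_nb_self[of v] leaf1 v by simp
  finally have "(\<Sum>u\<in>?Z. ?a u) = 0" using inner_X_eq by simp
  then have "nb u \<inter> X = {}" if "u \<in> ?Z" for u
    using that fin XY by simp
  with v leaf show thesis using that by blast
qed

lemma in_extremal_family: "(V, E) \<in> extremal_family n k"
proof -
  obtain v where v: "v \<in> X" "2 * card (nb v \<inter> X) = k"
    and leaf: "\<And>x. x \<in> nb v \<inter> X \<Longrightarrow> nb x \<inter> X = {v}"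
    and rest: "\<And>x. x \<in> X - {v} - nb v \<Longrightarrow> nb x \<inter> X = {}"
    using ex_star by metis
  \<comment> \<open>The centre \<open>v\<close> becomes the extra vertex of the family; without it
    the two parts have equal size.\<close>
  define X' where "X' = X - {v}"
  define A where "A = nb v \<inter> X"
  define B where "B = nb v \<inter> Y"
  define r where "r = (n + 1 - 2 * k) div 2"
  define r' where "r' = (n - 1 - 2 * k) div 2"
  have n: "n = 2 * card Y + 1" using XY card_X by simp
  have r: "r + k = card Y + 1" and r': "r' + k = card Y"
    unfolding r_def r'_def using n k_upper by auto
  have vY: "v \<notin> Y" using v X_Int_Y by auto
  have finX': "finite X'" and X'Y: "X' \<inter> Y = {}" using XY X_Int_Y by (auto simp: X'_def)
  have finA: "finite A" "finite B" using fin_nb by (auto simp: A_def B_def)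
  have AX': "A \<subseteq> X'" "B \<subseteq> Y" using not_nb_self[of v] by (auto simp: A_def B_def X'_def)
  have cX': "card X' = card Y" using v XY card_X by (simp add: X'_def)
  have nb_v: "nb v = A \<union> B" using nb_sub X_Un_Y by (auto simp: A_def B_def)
  have cA: "2 * card A = k" using v by (simp add: A_def)
  have "A \<inter> B = {}" using AX' X'Y by auto
  then have cB: "2 * card B = k"
    using card_Un_disjoint[OF finA] nb_v card_nb[of v] v XY cA by auto
  have nb_Y: "nb y \<subseteq> X" if "y \<in> Y" for y
  proof -
    have "nb y \<inter> Y = {}"
      using equality_case(1) that XY fin_nb by (simp add: inner_def)
    then show ?thesis using nb_sub X_Un_Y by blast
  qed
  have nb_A: "nb x = insert v (nb x \<inter> Y)" "Y - B \<subseteq> nb x" if "x \<in> A" for x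
  proof -
    have "nb x \<inter> X = {v}" using leaf that by (simp add: A_def)
    then show "nb x = insert v (nb x \<inter> Y)" using nb_sub X_Un_Y by blast
    have "Y \<subseteq> nb v \<union> nb x" using equality_case(3)[of v x] v that by (simp add: A_def)
    then show "Y - B \<subseteq> nb x" by (auto simp: B_def)
  qed
  have nb_X': "nb x \<subseteq> Y" if "x \<in> X' - A" for x
    using rest[of x] that nb_sub X_Un_Y unfolding X'_def A_def by blast
  have card_Y_diff: "card (Y - nb x) + card (nb x \<inter> Y) = card Y" for x
    by (rule card_Diff_Int[OF XY(4)])
  have card_X'_diff: "card (X' - nb x) + card (nb x \<inter> X') = card X'" for x
    by (rule card_Diff_Int[OF finX'])
  \<comment> \<open>Such an \<open>x\<close> is joined to \<open>v\<close> and to all of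
    \<open>Y - B\<close>, so its \<open>card Y - (k - 1)\<close> non-neighbours in \<open>Y\<close>
    all lie in \<open>B\<close>.\<close>
  have missA: "card (B - nb x) = r" if x: "x \<in> A" for x
  proof -
    have "card (nb x) = Suc (card (nb x \<inter> Y))"
      using nb_A(1)[OF x] vY fin_nb by (metis IntD2 card_insert_disjoint finite_Int)
    moreover have "card (nb x) = k" using card_nb x AX' XY by (auto simp: X'_def)
    moreover have "B - nb x = Y - nb x" using nb_A(2)[OF x] AX' by auto
    ultimately show ?thesis using card_Y_diff[of x] r by simp
  qed
  have missB': "card (X' - nb y) = r" if y: "y \<in> B" for y
  proof -
    have "nb y = insert v (nb y \<inter> X')"
      using nb_Y[of y] y AX' v nb_sym[of y v] by (auto simp: X'_def B_def)
    then have "card (nb y) = Suc (card (nb y \<inter> X'))"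
      using fin_nb by (metis X'_def Diff_iff IntD2 card_insert_disjoint finite_Int singletonI)
    moreover have "card (nb y) = k" using card_nb y XY by (auto simp: B_def)
    ultimately show ?thesis using card_X'_diff[of y] r cX' by simp
  qed
  \<comment> \<open>Double counting of the non-adjacent pairs between \<open>A\<close> and
    \<open>B\<close>: from \<open>A\<close> there are \<open>card A * r\<close>. Each vertex of
    \<open>B\<close> has only \<open>r\<close> non-neighbours in \<open>X'\<close>, and
    \<open>card A = card B\<close>, so all of these lie in \<open>A\<close>.\<close>
  have missB_eq: "A - nb y = X' - nb y" if y: "y \<in> B" for y
  proof -
    have le: "card (A - nb y) \<le> card (X' - nb y)" for y
      using AX' finX' by (intro card_mono) auto
    have "(\<Sum>y\<in>B. card (A - nb y) + card (nb y \<inter> A)) = (\<Sum>y\<in>B. card A)"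
      by (intro sum.cong card_Diff_Int finA) simp
    then have 1: "(\<Sum>y\<in>B. card (A - nb y)) + (\<Sum>y\<in>B. card (nb y \<inter> A)) = card B * card A"
      by (simp add: sum.distrib)
    have "(\<Sum>x\<in>A. card (B - nb x) + card (nb x \<inter> B)) = (\<Sum>x\<in>A. card B)"
      by (intro sum.cong card_Diff_Int finA) simp
    then have 2: "(\<Sum>x\<in>A. card (B - nb x)) + (\<Sum>x\<in>A. card (nb x \<inter> B)) = card A * card B"
      by (simp add: sum.distrib)
    have "(\<Sum>x\<in>A. card (B - nb x)) = card A * r" using missA by simp
    moreover have "(\<Sum>y\<in>B. card (X' - nb y)) = card B * r" using missB' by simp
    moreover have "card A = card B" using cA cB by simp
    ultimately have "(\<Sum>y\<in>B. card (A - nb y)) = (\<Sum>y\<in>B. card (X' - nb y))"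
      using 1 2 cross_count[OF finA] by simp
    then have "card (A - nb y) = card (X' - nb y)"
      using sum_mono_inv[of "\<lambda>y. card (A - nb y)" B "\<lambda>y. card (X' - nb y)" y] le y finA by auto
    then show ?thesis using AX' finX' by (intro card_subset_eq) auto
  qed
  have missX': "card (Y - B - nb x) = r'" if x: "x \<in> X' - A" for x
  proof -
    have "B \<subseteq> nb x"
    proof
      fix y assume "y \<in> B"
      then show "y \<in> nb x" using missB_eq[of y] x nb_sym[of x y] by auto
    qed
    then have "Y - B - nb x = Y - nb x" by auto
    moreover have "nb x \<inter> Y = nb x" using nb_X'[OF x] by auto
    moreover have "card (nb x) = k" using card_nb x XY by (auto simp: X'_def)
    ultimately show ?thesis using card_Y_diff[of x] r' by simp
  qed
  have missY: "card (X' - A - nb y) = r'" if y: "y \<in> Y - B" for y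
  proof -
    have "A \<subseteq> nb y" using nb_A(2) y nb_sym by blast
    then have "X' - A - nb y = X' - nb y" by auto
    moreover have "v \<notin> nb y" using y nb_sym[of v y] by (auto simp: B_def)
    then have "nb y \<inter> X' = nb y" using nb_Y[of y] y by (auto simp: X'_def)
    moreover have "card (nb y) = k" using card_nb y XY by auto
    ultimately show ?thesis using card_X'_diff[of y] r' cX' by simp
  qed
  define F1 where "F1 = bipartite_edges A B (\<lambda>x y. y \<notin> nb x)"
  define F2 where "F2 = bipartite_edges (X' - A) (Y - B) (\<lambda>x y. y \<notin> nb x)"
  have set1: "{y \<in> S. y \<notin> nb x} = S - nb x" for S x by auto
  have set2: "{x \<in> S. y \<notin> nb x} = S - nb y" for S y using nb_sym by blast
  have "regular_graph r (A \<union> B) F1"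
    unfolding F1_def using finA AX' X'Y missA missB' missB_eq
    by (intro regular_bipartite_edges) (auto simp: set1 set2)
  moreover have "F1 \<subseteq> induced_edges (complete_bipartite_edges X' Y) (A \<union> B)"
    unfolding F1_def bipartite_edges_def induced_edges_def complete_bipartite_edges_def
    using AX' by auto
  ultimately have f1: "is_factor r (A \<union> B) (induced_edges (complete_bipartite_edges X' Y) (A \<union> B)) F1"
    by (simp add: is_factor_def)
  have "regular_graph r' ((X' - A) \<union> (Y - B)) F2"
    unfolding F2_def
  proof (rule regular_bipartite_edges)
    show "card {y \<in> Y - B. y \<notin> nb x} = r'" if "x \<in> X' - A" for x
      unfolding set1 using missX'[OF that] .
    show "card {x \<in> X' - A. y \<notin> nb x} = r'" if "y \<in> Y - B" for y
      unfolding set2 using missY[OF that] .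
  qed (use finX' XY(4) X'Y in auto)
  moreover have "F2 \<subseteq> induced_edges (complete_bipartite_edges X' Y) ((X' - A) \<union> (Y - B))"
    unfolding F2_def bipartite_edges_def induced_edges_def complete_bipartite_edges_def by auto
  ultimately have f2: "is_factor r' ((X' - A) \<union> (Y - B))
      (induced_edges (complete_bipartite_edges X' Y) ((X' - A) \<union> (Y - B))) F2"
    by (simp add: is_factor_def)
  have F1_iff: "{x, y} \<in> F1 \<longleftrightarrow> x \<in> A \<and> y \<in> B \<and> y \<notin> nb x" if "x \<in> X'" "y \<in> Y" for x y
    using that AX' X'Y by (auto simp: F1_def bipartite_edges_def doubleton_eq_iff)
  have F2_iff: "{x, y} \<in> F2 \<longleftrightarrow> x \<in> X' - A \<and> y \<in> Y - B \<and> y \<notin> nb x" if "x \<in> X'" "y \<in> Y" for x y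
    using that AX' X'Y by (auto simp: F2_def bipartite_edges_def doubleton_eq_iff)
  have E_iff: "{x, y} \<in> E \<longleftrightarrow> y \<in> nb x" for x y by (simp add: nb_def)
  have EX'Y: "{x, y} \<in> E \<longleftrightarrow> {x, y} \<notin> F1 \<and> {x, y} \<notin> F2" if xy: "x \<in> X'" "y \<in> Y" for x y
  proof -
    have "y \<in> nb x" if "x \<in> A" "y \<notin> B" using nb_A(2) that xy by auto
    moreover have "y \<in> nb x" if "x \<notin> A" "y \<in> B"
      using missB_eq[OF that(2)] that xy nb_sym[of x y] by auto
    ultimately show ?thesis using F1_iff F2_iff E_iff xy by auto
  qed
  have E_eq: "E = (complete_bipartite_edges X' Y - F1 - F2) \<union> {{v, u} | u. u \<in> A \<union> B}"
  proof (intro subset_antisym subsetI)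
    fix e assume e: "e \<in> E"
    then obtain x y where xy: "e = {x, y}" using edge_card[OF e] by (auto simp: card_2_iff)
    then have y: "y \<in> nb x" and x: "x \<in> nb y" using e E_iff nb_sym by auto
    have V: "x \<in> X \<union> Y" "y \<in> X \<union> Y" using y nb_in nb_sub X_Un_Y by auto
    have noX: "\<not> (a \<in> X' \<and> b \<in> X')" if "b \<in> nb a" for a b
    proof
      assume ab: "a \<in> X' \<and> b \<in> X'"
      then have "b \<in> nb a \<inter> X" "b \<noteq> v" using that by (auto simp: X'_def)
      then show False using leaf[of a] rest[of a] ab by (auto simp: X'_def)
    qed
    consider "x = v" | "y = v" | "x \<in> X'" "y \<in> Y" | "y \<in> X'" "x \<in> Y"
      using V noX[OF y] nb_Y[of x] y X_Int_Y by (auto simp: X'_def)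
    then show "e \<in> (complete_bipartite_edges X' Y - F1 - F2) \<union> {{v, u} | u. u \<in> A \<union> B}"
    proof cases
      case 1
      then show ?thesis using y nb_v xy by auto
    next
      case 2
      then show ?thesis using x nb_v xy by (auto simp: insert_commute)
    next
      case 3
      then show ?thesis using EX'Y[OF 3] e xy by (auto simp: complete_bipartite_edges_def)
    next
      case 4
      then show ?thesis using EX'Y[OF 4] e xy
        by (auto simp: complete_bipartite_edges_def insert_commute)
    qed
  next
    fix e assume "e \<in> (complete_bipartite_edges X' Y - F1 - F2) \<union> {{v, u} | u. u \<in> A \<union> B}"
    then show "e \<in> E"
    proof
      assume "e \<in> complete_bipartite_edges X' Y - F1 - F2"
      then obtain x y where "e = {x, y}" "x \<in> X'" "y \<in> Y" "e \<notin> F1" "e \<notin> F2"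
        by (auto simp: complete_bipartite_edges_def)
      then show ?thesis using EX'Y[of x y] by simp
    next
      assume "e \<in> {{v, u} | u. u \<in> A \<union> B}"
      then show ?thesis using nb_v E_iff by blast
    qed
  qed
  have cards: "card X' = (n - 1) div 2" "card Y = (n - 1) div 2" "card A = k div 2" "card B = k div 2"
    using n cX' cA cB by auto
  have V_eq: "V = insert v (X' \<union> Y)" using X_Un_Y v by (auto simp: X'_def)
  have vn: "v \<notin> X' \<union> Y" using vY by (simp add: X'_def)
  show ?thesis
    unfolding extremal_family_def
    using finX' XY(4) X'Y cards AX' vn f1[unfolded r_def] f2[unfolded r'_def] V_eq E_eq
    by blast
qed

end

text \<open>Serves both claims: a count below the formula contradicts the equality, and an exact
  count gives membership in the family.\<close>

lemma regular_graph_triangles: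
  fixes V :: "'a set" and n k :: nat
  assumes "regular_graph k V E" "card V = n" "10 ^ 9 \<le> n" "odd n" "even k" "2 * n < 5 * k" "2 * k < n"
    and few: "4 * card (triangles V E) + k * (n + 1) \<le> 3 * k * k"
  shows "4 * card (triangles V E) + k * (n + 1) = 3 * k * k \<and> (V, E) \<in> extremal_family n k"
proof -
  interpret few_triangles V E k n
    by unfold_locales (use assms in auto)
  obtain X Y where XY: "X \<union> Y = V" "X \<inter> Y = {}" "card Y < card X" "inner X + inner Y \<le> 4955 * k"
    "\<And>x. x \<in> X \<Longrightarrow> 2 * card (nb x \<inter> X) \<le> k" "\<And>y. y \<in> Y \<Longrightarrow> 2 * card (nb y \<inter> Y) \<le> k"
    "inner X + card Y * k = inner Y + card X * k"
    using ex_good_partition by metis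
  interpret good_partition V E k n X Y
    by unfold_locales (use XY in auto)
  have "real (4 * t + k * (n + 1)) = real (3 * k * k)"
    using equality_case(2) by (simp add: algebra_simps)
  then have "4 * t + k * (n + 1) = 3 * k * k" by (simp only: of_nat_eq_iff)
  then show ?thesis using in_extremal_family by simp
qed

section \<open>Existence of a graph attaining the bound\<close>

lemma card_shifted_residues_less:
  fixes p r i :: nat
  assumes "r \<le> p"
  shows "card {j \<in> {..<p}. (i + j) mod p < r} = r"
proof -
  let ?f = "\<lambda>j. (i + j) mod p"
  have le: "j = j'" if "j' \<le> j" "j < p" "?f j = ?f j'" for j j'
  proof -
    have "p dvd (i + j) - (i + j')" using that by (intro mod_eq_dvd_iff_nat[THEN iffD1]) auto
    then show ?thesis using that dvd_imp_le[of p "j - j'"] by fastforce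
  qed
  have inj: "inj_on ?f {..<p}"
    by (rule inj_onI) (metis le lessThan_iff nat_le_linear)
  have "?f ` {..<p} = {..<p}"
    using inj by (intro endo_inj_surj) auto
  then have "?f ` {j \<in> {..<p}. ?f j < r} = {..<r}"
    using assms by (auto simp: image_iff set_eq_iff) (metis lessThan_iff order_less_le_trans)
  then show ?thesis
    using card_image[OF inj_on_subset[OF inj Collect_restrict]] by (metis card_lessThan)
qed

text \<open>A circulant relation: both sets are numbered by residues modulo \<open>p\<close>, and
  two elements are related if their sum modulo \<open>p\<close> is below \<open>r\<close>.\<close>

lemma ex_biregular_relation:
  fixes P Q :: "'a set"
  assumes "finite P" "finite Q" "card P = p" "card Q = p" "r \<le> p"
  obtains R where "\<And>x. card {y \<in> Q. R x y} = r" "\<And>y. card {x \<in> P. R x y} = r"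
proof -
  obtain f where f: "bij_betw f P {..<p}"
    using finite_same_card_bij[of P "{..<p}"] assms by auto
  obtain g where g: "bij_betw g Q {..<p}"
    using finite_same_card_bij[of Q "{..<p}"] assms by auto
  have pre: "card {x \<in> S. (i + h x) mod p < r} = r" if "bij_betw h S {..<p}" for S :: "'a set" and h i
  proof -
    have "h ` {x \<in> S. (i + h x) mod p < r} = {j \<in> {..<p}. (i + j) mod p < r}"
      unfolding bij_betw_imp_surj_on[OF that, symmetric] by auto
    moreover have "inj_on h {x \<in> S. (i + h x) mod p < r}"
      by (rule inj_on_subset[OF bij_betw_imp_inj_on[OF that] Collect_restrict])
    ultimately show ?thesis
      using card_image[of h "{x \<in> S. (i + h x) mod p < r}"] card_shifted_residues_less[OF \<open>r \<le> p\<close>, of i]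
      by simp
  qed
  show thesis
  proof (rule that[of "\<lambda>x y. (f x + g y) mod p < r"])
    show "card {y \<in> Q. (f x + g y) mod p < r} = r" for x by (rule pre[OF g])
    show "card {x \<in> P. (f x + g y) mod p < r} = r" for y
      using pre[OF f, of "g y"] by (simp only: add.commute[of "g y"])
  qed
qed

text \<open>The graph constructed is the member of \<open>\<G>(2h + 1, 2q)\<close> with \<open>X = A \<union> A'\<close> and \<open>Y = B \<union> B'\<close>
  whose factors are the relations \<open>R\<close> and \<open>R'\<close>.\<close>

lemma ex_regular_graph_few_triangles:
  fixes q h :: nat
  assumes "2 * q \<le> h" "2 * h + 1 < 5 * q"
  shows "\<exists>E. regular_graph (2 * q) {..<2 * h + 1} E \<and>
    card (triangles {..<2 * h + 1} E) \<le> q * (3 * q - h - 1)"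
proof -
  define A where "A = {..<q}"
  define A' where "A' = {q..<h}"
  define B where "B = {h..<h + q}"
  define B' where "B' = {h + q..<2 * h}"
  define v where "v = 2 * h"
  define V where "V = {..<2 * h + 1}"
  note defs = A_def A'_def B_def B'_def v_def
  have fin: "finite A" "finite A'" "finite B" "finite B'" by (auto simp: defs)
  have cards: "card A = q" "card A' = h - q" "card B = q" "card B' = h - q"
    by (auto simp: defs)
  have disj: "A \<inter> A' = {}" "A \<inter> B = {}" "A \<inter> B' = {}" "A' \<inter> B = {}" "A' \<inter> B' = {}" "B \<inter> B' = {}"
    "v \<notin> A" "v \<notin> A'" "v \<notin> B" "v \<notin> B'"
    using assms by (auto simp: defs)
  have V: "V = insert v (A \<union> A' \<union> B \<union> B')" using assms by (auto simp: defs V_def)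
  \<comment> \<open>\<open>R\<close> and \<open>R'\<close> are the deleted pairs. With
    \<open>n = 2h + 1\<close> and \<open>k = 2q\<close>, their degrees are
    \<open>(n - 2k + 1)/2\<close> and \<open>(n - 2k - 1)/2\<close>.\<close>
  obtain R where R: "\<And>x. card {y \<in> B. R x y} = h + 1 - 2 * q" "\<And>y. card {x \<in> A. R x y} = h + 1 - 2 * q"
    by (rule ex_biregular_relation[of A B q "h + 1 - 2 * q"]) (use fin cards assms in auto)
  obtain R' where R': "\<And>x. card {y \<in> B'. R' x y} = h - 2 * q" "\<And>y. card {x \<in> A'. R' x y} = h - 2 * q"
    by (rule ex_biregular_relation[of A' B' "h - q" "h - 2 * q"]) (use fin cards assms in auto)
  have not_R: "card {y \<in> S. \<not> T y} = card S - card {y \<in> S. T y}" if "finite S" for S :: "nat set" and T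
  proof -
    have "{y \<in> S. \<not> T y} = S - {y \<in> S. T y}" by auto
    then show ?thesis using that by (simp add: card_Diff_subset)
  qed
  define e where "e x y \<longleftrightarrow> x \<in> A \<and> y \<in> B \<and> \<not> R x y \<or> x \<in> A' \<and> y \<in> B' \<and> \<not> R' x y \<or>
    x \<in> A \<and> y \<in> B' \<or> x \<in> A' \<and> y \<in> B \<or> x = v \<and> y \<in> A \<union> B" for x y
  define E where "E = {{x, y} | x y. e x y}"
  have E_iff: "{x, y} \<in> E \<longleftrightarrow> e x y \<or> e y x" for x y
    unfolding E_def by (auto simp: doubleton_eq_iff)
  have e_V: "x \<in> V" "y \<in> V" "x \<noteq> y" if "e x y" for x y
    using that disj by (auto simp: e_def V)
  have simple: "simple_graph V E"
    unfolding simple_graph_def E_def using e_V by (auto simp: card_insert_if V_def)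
  have "card {y. {x, y} \<in> E} = 2 * q" if x: "x \<in> V" for x
  proof -
    consider "x = v" | "x \<in> A" | "x \<in> A'" | "x \<in> B" | "x \<in> B'" using x V by auto
    then show ?thesis
    proof cases
      case 1
      have "{y. {x, y} \<in> E} = A \<union> B" unfolding E_iff e_def using 1 disj by auto
      then show ?thesis using fin cards disj by (simp add: card_Un_disjoint)
    next
      case 2
      then have "{y. {x, y} \<in> E} = insert v ({y \<in> B. \<not> R x y} \<union> B')" unfolding E_iff e_def using disj by auto
      moreover have "card ({y \<in> B. \<not> R x y} \<union> B') = card {y \<in> B. \<not> R x y} + card B'"
        using fin disj by (intro card_Un_disjoint) auto
      ultimately show ?thesis using fin cards disj assms by (simp add: not_R R)
    next
      case 3
      then have "{y. {x, y} \<in> E} = B \<union> {y \<in> B'. \<not> R' x y}" unfolding E_iff e_def using disj by auto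
      moreover have "card (B \<union> {y \<in> B'. \<not> R' x y}) = card B + card {y \<in> B'. \<not> R' x y}"
        using fin disj by (intro card_Un_disjoint) auto
      ultimately show ?thesis using fin cards assms by (simp add: not_R R')
    next
      case 4
      then have "{y. {x, y} \<in> E} = insert v ({y \<in> A. \<not> R y x} \<union> A')" unfolding E_iff e_def using disj by auto
      moreover have "card ({y \<in> A. \<not> R y x} \<union> A') = card {y \<in> A. \<not> R y x} + card A'"
        using fin disj by (intro card_Un_disjoint) auto
      ultimately show ?thesis using fin cards disj assms by (simp add: not_R R)
    next
      case 5
      then have "{y. {x, y} \<in> E} = A \<union> {y \<in> A'. \<not> R' y x}" unfolding E_iff e_def using disj by auto
      moreover have "card (A \<union> {y \<in> A'. \<not> R' y x}) = card A + card {y \<in> A'. \<not> R' y x}"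
        using fin disj by (intro card_Un_disjoint) auto
      ultimately show ?thesis using fin cards assms by (simp add: not_R R')
    qed
  qed
  then have reg: "regular_graph (2 * q) V E"
    using simple by (simp add: regular_graph_def graph_degree_eq[OF simple])
  define P where "P = (SIGMA x:A. {y \<in> B. \<not> R x y})"
  have finP: "finite P" using fin by (auto simp: P_def)
  \<comment> \<open>Without \<open>v\<close> the graph is bipartite, so a triangle consists of
    \<open>v\<close> and an edge between \<open>A\<close> and \<open>B\<close>.\<close>
  have "triangles V E \<subseteq> (\<lambda>(x, y). {v, x, y}) ` P"
  proof
    fix T assume T: "T \<in> triangles V E"
    then have TE: "e x y \<or> e y x" if "x \<in> T" "y \<in> T" "x \<noteq> y" for x y
      using that E_iff by (auto simp: triangles_def)
    have cross: "x \<in> A \<union> A' \<longleftrightarrow> y \<notin> A \<union> A'" if "x \<noteq> v" "y \<noteq> v" "e x y \<or> e y x" for x y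
      using that disj by (auto simp: e_def)
    have "v \<in> T"
    proof (rule ccontr)
      assume v: "v \<notin> T"
      obtain x y z where xyz: "T = {x, y, z}" "x \<noteq> y" "x \<noteq> z" "y \<noteq> z"
        using T by (auto simp: triangles_def card_3_iff)
      then show False
        using cross[of x y] cross[of x z] cross[of y z] TE v by auto
    qed
    then have "card (T - {v}) = 2" using T by (simp add: triangles_def)
    then obtain x y where xy: "T - {v} = {x, y}" "x \<noteq> y" by (auto simp: card_2_iff)
    then have T_eq: "T = {v, x, y}" "x \<noteq> v" "y \<noteq> v" using \<open>v \<in> T\<close> by auto
    have "x \<in> A \<union> B" "y \<in> A \<union> B"
      using TE[of v x] TE[of v y] T_eq disj by (auto simp: e_def)
    then have "(x, y) \<in> P \<or> (y, x) \<in> P"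
      using TE[of x y] xy T_eq disj by (auto simp: e_def P_def)
    then show "T \<in> (\<lambda>(x, y). {v, x, y}) ` P"
      using T_eq by (auto simp: image_iff insert_commute)
  qed
  then have "card (triangles V E) \<le> card ((\<lambda>(x, y). {v, x, y}) ` P)"
    using finP by (intro card_mono) auto
  also have "\<dots> \<le> card P" using finP by (rule card_image_le)
  also have "\<dots> = q * (q - (h + 1 - 2 * q))"
    unfolding P_def using fin cards by (simp add: not_R R)
  also have "q - (h + 1 - 2 * q) = 3 * q - h - 1" using assms by simp
  finally show ?thesis using reg unfolding V_def by blast
qed

theorem theorem1p3:
  fixes n k :: nat
  assumes "n \<ge> 10 ^ 9" and "odd n" and "even k"
    and "2 * real n / 5 < real k" and "real k < real n / 2"
  shows "real (min_triangles n k) = real k / 4 * (3 * real k - real n - 1) \<and>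
    (\<forall>(V :: 'a set) E. card V = n \<and> regular_graph k V E \<and>
        card (triangles V E) = min_triangles n k \<longrightarrow> (V, E) \<in> extremal_family n k)"
proof -
  have k: "2 * n < 5 * k" "2 * k < n" using assms(4,5) by linarith+
  obtain q where q: "k = 2 * q" using assms(3) by (elim evenE)
  obtain h where h: "n = 2 * h + 1" using assms(2) by (elim oddE)
  \<comment> \<open>This is \<open>k(3k - n - 1)/4\<close> in terms of \<open>q\<close> and
    \<open>h\<close>, an integer.\<close>
  define m where "m = q * (3 * q - h - 1)"
  have "real m = real q * (3 * real q - real h - 1)"
    unfolding m_def using k q h by (simp add: of_nat_diff)
  then have "4 * real m + real k * (real n + 1) = 3 * real k * real k"
    unfolding q h by (simp add: algebra_simps)
  then have "real (4 * m + k * (n + 1)) = real (3 * k * k)" by (simp add: algebra_simps)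
  then have m: "4 * m + k * (n + 1) = 3 * k * k" by (simp only: of_nat_eq_iff)
  \<comment> \<open>Stated over \<open>nat\<close> because \<open>min_triangles\<close> ranges over
    graphs on \<open>{..<n}\<close>; the uniqueness claim concerns an arbitrary vertex type.\<close>
  have lower: "m \<le> card (triangles V E)" if "regular_graph k V E" "card V = n" for V :: "nat set" and E
  proof (rule ccontr)
    assume "\<not> m \<le> card (triangles V E)"
    then have "4 * card (triangles V E) + k * (n + 1) < 3 * k * k" using m by simp
    then show False
      using regular_graph_triangles[OF that assms(1-3) k] by simp
  qed
  obtain E where E: "regular_graph k {..<n} E" "card (triangles {..<n} E) \<le> m"
    using ex_regular_graph_few_triangles[of q h] k unfolding q h m_def by auto
  have "card (triangles {..<n} E) = m" using E lower[OF E(1)] by simp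
  then have min: "min_triangles n k = m"
    unfolding min_triangles_def using E(1) lower by (intro cInf_eq_minimum) auto
  have "real m = real k / 4 * (3 * real k - real n - 1)"
    using \<open>4 * real m + real k * (real n + 1) = 3 * real k * real k\<close> by (simp add: field_simps)
  moreover have "(V, E) \<in> extremal_family n k"
    if "card V = n" "regular_graph k V E" "card (triangles V E) = m" for V :: "'a set" and E
    using regular_graph_triangles[OF that(2,1) assms(1-3) k] that(3) m by simp
  ultimately show ?thesis using min by blast
qed

end
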